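(* Let $s>1$ and put $$u_+=\frac{3s-\sqrt{s^2+8}}{2}<s,\qquad h_+=\frac{u_+}{s-u_+}.$$ For $\varepsilon,\delta>0$ consider traveling wave solutions, propagating with speed $s$ (functions of $x-st$), of the dissipative Peregrine–Boussinesq system $$\eta_t+u_x+(\eta u)_x=0,\qquad u_t+\eta_x+uu_x-\delta u_{xxt}-\varepsilon u_{xx}=0$$ with $(\eta,u)\to(0,0)$ as $x-st\to+\infty$ and $(\eta,u)\to(h_+,u_+)$ as $x-st\to-\infty$. If $\delta=o(\varepsilon)$ as $\varepsilon,\delta\to0$, then these traveling waves tend to entropic (classical) shock waves of the shallow water wave equations $$\eta_t+u_x+(\eta u)_x=0,\qquad u_t+\eta_x+uu_x=0.$$ This holds even in the regime $\varepsilon^2<4\delta s\,\alpha(s)$, in which the traveling waves describe undular bores, where $$\alpha(s)=\frac{s-\sqrt{s^2+8}}{2}+\frac{4s}{(s-\sqrt{s^2+8})^2}.$$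
   Context: Here $\eta$ is the free-surface elevation and $u$ the horizontal velocity of the fluid. The existence of the traveling waves is known from earlier work. With $\tau=-(x-st)/\sqrt{s\delta}$, such a wave satisfies $\eta=u/(s-u)$ and $u''+cu'+\phi(u)=0$ with $c=\varepsilon/\sqrt{s\delta}$, $\phi(u)=-su+\frac{u}{s-u}+\frac12u^2$, $u\to0$ as $\tau\to-\infty$ and $u\to u_+$ as $\tau\to+\infty$. The value of $u_+$ is the one dictated by the Rankine–Hugoniot conditions. *)

theory Defs
  imports "HOL-Analysis.Analysis" "HOL-Library.Landau_Symbols"
begin

definition Dx :: "(real \<Rightarrow> real \<Rightarrow> real) \<Rightarrow> real \<Rightarrow> real \<Rightarrow> real" where
  "Dx f x t = deriv (\<lambda>y. f y t) x"

definition Dt :: "(real \<Rightarrow> real \<Rightarrow> real) \<Rightarrow> real \<Rightarrow> real \<Rightarrow> real" where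
  "Dt f x t = deriv (\<lambda>r. f x r) t"

definition x_differentiable :: "(real \<Rightarrow> real \<Rightarrow> real) \<Rightarrow> bool" where
  "x_differentiable f \<longleftrightarrow> (\<forall>x t. (\<lambda>y. f y t) field_differentiable (at x))"

definition t_differentiable :: "(real \<Rightarrow> real \<Rightarrow> real) \<Rightarrow> bool" where
  "t_differentiable f \<longleftrightarrow> (\<forall>x t. (\<lambda>r. f x r) field_differentiable (at t))"

definition wave :: "real \<Rightarrow> (real \<Rightarrow> real) \<Rightarrow> real \<Rightarrow> real \<Rightarrow> real" where
  "wave s f x t = f (x - s * t)"

text \<open>Classical solutions: every derivative that occurs in the system is required to exist
  (continuity of these derivatives is not needed).\<close>

definition peregrine_boussinesq ::
  "real \<Rightarrow> real \<Rightarrow> (real \<Rightarrow> real \<Rightarrow> real) \<Rightarrow> (real \<Rightarrow> real \<Rightarrow> real) \<Rightarrow> bool" where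
  "peregrine_boussinesq \<epsilon> \<delta> \<eta> u \<longleftrightarrow>
     x_differentiable \<eta> \<and> t_differentiable \<eta> \<and>
     x_differentiable u \<and> t_differentiable u \<and>
     x_differentiable (Dx u) \<and> t_differentiable (Dx (Dx u)) \<and>
     (\<forall>x t. Dt \<eta> x t + Dx u x t + Dx (\<lambda>x t. \<eta> x t * u x t) x t = 0) \<and>
     (\<forall>x t. Dt u x t + Dx \<eta> x t + u x t * Dx u x t
              - \<delta> * Dt (Dx (Dx u)) x t - \<epsilon> * Dx (Dx u) x t = 0)"

definition u_plus :: "real \<Rightarrow> real" where
  "u_plus s = (3 * s - sqrt (s\<^sup>2 + 8)) / 2"

definition h_plus :: "real \<Rightarrow> real" where
  "h_plus s = u_plus s / (s - u_plus s)"

definition alpha :: "real \<Rightarrow> real" where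
  "alpha s = (s - sqrt (s\<^sup>2 + 8)) / 2 + 4 * s / (s - sqrt (s\<^sup>2 + 8))\<^sup>2"

definition traveling_wave ::
  "real \<Rightarrow> real \<Rightarrow> real \<Rightarrow> (real \<Rightarrow> real) \<Rightarrow> (real \<Rightarrow> real) \<Rightarrow> bool" where
  "traveling_wave \<epsilon> \<delta> s H U \<longleftrightarrow>
     peregrine_boussinesq \<epsilon> \<delta> (wave s H) (wave s U) \<and>
     (H \<longlongrightarrow> 0) at_top \<and> (U \<longlongrightarrow> 0) at_top \<and>
     (H \<longlongrightarrow> h_plus s) at_bot \<and> (U \<longlongrightarrow> u_plus s) at_bot"

text \<open>A bore is undular if it approaches the state behind it (at \<open>x - s t \<rightarrow> - \<infinity>\<close>) through
  infinitely many oscillations about that state.\<close>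

definition oscillates_about :: "real \<Rightarrow> (real \<Rightarrow> real) \<Rightarrow> bool" where
  "oscillates_about l f \<longleftrightarrow>
     (\<exists>\<^sub>F \<xi> in at_bot. f \<xi> > l) \<and> (\<exists>\<^sub>F \<xi> in at_bot. f \<xi> < l)"

definition undular_bore :: "real \<Rightarrow> (real \<Rightarrow> real) \<Rightarrow> (real \<Rightarrow> real) \<Rightarrow> bool" where
  "undular_bore s H U \<longleftrightarrow>
     oscillates_about (h_plus s) H \<and> oscillates_about (u_plus s) U"

definition test_function :: "(real \<Rightarrow> real \<Rightarrow> real) \<Rightarrow> bool" where
  "test_function \<psi> \<longleftrightarrow>
     x_differentiable \<psi> \<and> t_differentiable \<psi> \<and>
     continuous_on UNIV (\<lambda>(x, t). Dx \<psi> x t) \<and> continuous_on UNIV (\<lambda>(x, t). Dt \<psi> x t) \<and>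
     (\<exists>K. compact K \<and> (\<forall>x t. (x, t) \<notin> K \<longrightarrow> \<psi> x t = 0))"

text \<open>Weak solutions of the system in the conservation form
  \<open>\<eta>\<^sub>t + (u + \<eta> u)\<^sub>x = 0\<close>, \<open>u\<^sub>t + (\<eta> + u\<^sup>2/2)\<^sub>x = 0\<close>.\<close>

definition swe_weak_solution ::
  "(real \<Rightarrow> real \<Rightarrow> real) \<Rightarrow> (real \<Rightarrow> real \<Rightarrow> real) \<Rightarrow> bool" where
  "swe_weak_solution \<eta> u \<longleftrightarrow>
     (\<forall>\<psi>. test_function \<psi> \<longrightarrow>
        has_bochner_integral lborel
          (\<lambda>(x, t). \<eta> x t * Dt \<psi> x t + (u x t + \<eta> x t * u x t) * Dx \<psi> x t) 0 \<and>
        has_bochner_integral lborel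
          (\<lambda>(x, t). u x t * Dt \<psi> x t + (\<eta> x t + (u x t)\<^sup>2 / 2) * Dx \<psi> x t) 0)"

text \<open>The physical entropy of the shallow water equations is the energy
  \<open>\<eta>\<^sup>2/2 + (1 + \<eta>) u\<^sup>2/2\<close>; its flux is the product of the two fluxes of the system.
  The inequality \<open>energy\<^sub>t + energy_flux\<^sub>x \<le> 0\<close> is meant in the sense of distributions.\<close>

definition swe_energy :: "real \<Rightarrow> real \<Rightarrow> real" where
  "swe_energy \<eta> u = \<eta>\<^sup>2 / 2 + (1 + \<eta>) * u\<^sup>2 / 2"

definition swe_energy_flux :: "real \<Rightarrow> real \<Rightarrow> real" where
  "swe_energy_flux \<eta> u = (u + \<eta> * u) * (\<eta> + u\<^sup>2 / 2)"

definition swe_energy_inequality ::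
  "(real \<Rightarrow> real \<Rightarrow> real) \<Rightarrow> (real \<Rightarrow> real \<Rightarrow> real) \<Rightarrow> bool" where
  "swe_energy_inequality \<eta> u \<longleftrightarrow>
     (\<forall>\<psi>. test_function \<psi> \<and> (\<forall>x t. \<psi> x t \<ge> 0) \<longrightarrow>
        (\<exists>I\<ge>0. has_bochner_integral lborel
          (\<lambda>(x, t). swe_energy (\<eta> x t) (u x t) * Dt \<psi> x t
                  + swe_energy_flux (\<eta> x t) (u x t) * Dx \<psi> x t) I))"

text \<open>Characteristic speeds, i.e. the eigenvalues of the flux Jacobian
  \<open>((u, 1 + \<eta>), (1, u))\<close>, at a state \<open>(\<eta>, u)\<close>.\<close>

definition char_speed1 :: "real \<times> real \<Rightarrow> real" where
  "char_speed1 = (\<lambda>(\<eta>, u). u - sqrt (1 + \<eta>))"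

definition char_speed2 :: "real \<times> real \<Rightarrow> real" where
  "char_speed2 = (\<lambda>(\<eta>, u). u + sqrt (1 + \<eta>))"

text \<open>Lax's shock condition for a jump of speed \<open>s\<close> from the left state \<open>L\<close> to the right
  state \<open>R\<close>, in the first or in the second characteristic family; both states lie in the region
  of strict hyperbolicity.\<close>

definition lax_condition :: "real \<Rightarrow> real \<times> real \<Rightarrow> real \<times> real \<Rightarrow> bool" where
  "lax_condition s L R \<longleftrightarrow>
     1 + fst L > 0 \<and> 1 + fst R > 0 \<and>
     (char_speed1 R < s \<and> s < char_speed1 L \<and> s < char_speed2 R \<or>
      char_speed2 R < s \<and> s < char_speed2 L \<and> char_speed1 L < s)"

definition jump :: "real \<Rightarrow> real \<Rightarrow> real \<Rightarrow> real \<Rightarrow> real \<Rightarrow> real" where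
  "jump s l r x t = (if x < s * t then l else r)"

definition entropic_shock_wave :: "real \<Rightarrow> real \<times> real \<Rightarrow> real \<times> real \<Rightarrow> bool" where
  "entropic_shock_wave s L R \<longleftrightarrow>
     L \<noteq> R \<and>
     swe_weak_solution (jump s (fst L) (fst R)) (jump s (snd L) (snd R)) \<and>
     swe_energy_inequality (jump s (fst L) (fst R)) (jump s (snd L) (snd R)) \<and>
     lax_condition s L R"

text \<open>Convergence in \<open>L\<^sup>1\<close> on compact subsets of space-time.\<close>

definition tends_L1_loc ::
  "('i \<Rightarrow> real \<Rightarrow> real \<Rightarrow> real) \<Rightarrow> (real \<Rightarrow> real \<Rightarrow> real) \<Rightarrow> 'i filter \<Rightarrow> bool" where
  "tends_L1_loc f g F \<longleftrightarrow>
     (\<forall>K :: (real \<times> real) set. compact K \<longrightarrow>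
        ((\<lambda>i. \<integral>\<^sup>+ p \<in> K. ennreal \<bar>f i (fst p) (snd p) - g (fst p) (snd p)\<bar> \<partial>lborel)
           \<longlongrightarrow> 0) F)"

end

theory Submission
  imports Defs
begin

text \<open>Both equations of the system integrate once, which leaves \<open>\<eta> = u / (s - u)\<close> and the damped
  oscillator \<open>\<delta> s u'' + \<epsilon> u' + \<phi>(u) = 0\<close> in the variable \<open>- (x - s t)\<close>, running from the saddle \<open>0\<close> to the
  centre \<open>u\<^sub>+\<close> of the potential \<open>\<Phi>\<close>. The energy \<open>E = \<delta> s u'\<^sup>2 / 2 + \<Phi>(u)\<close> decreases from \<open>0\<close>, hence \<open>u\<close> stays in
  a compact part of \<open>[0, s)\<close> and \<open>sqrt (\<delta> s) u'\<close> is bounded. Put the origin where \<open>u\<close> first reaches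
  \<open>u\<^sub>+ / 2\<close>. Before it, integrating the equation bounds the integral of \<open>u\<close> by \<open>O(sqrt \<delta> + \<epsilon>)\<close>. After it, the
  virial identity for the multiplier \<open>(u - u\<^sub>+) / sqrt (- E)\<close> bounds the integral of \<open>(u - u\<^sub>+)\<^sup>2\<close> by
  \<open>O(\<delta> / \<epsilon> + (sqrt \<delta> + \<epsilon>) / sqrt (- E(0)))\<close>, and \<open>- E(0)\<close> is at least of order \<open>min 1 (\<epsilon> / sqrt \<delta>)\<close>; both
  tend to \<open>0\<close> when \<open>\<delta> = o(\<epsilon>)\<close>, whether or not the profile oscillates. The linearisation at \<open>u\<^sub>+\<close> has
  \<open>\<phi>'(u\<^sub>+) = \<alpha>(s)\<close>, so it is underdamped exactly when \<open>\<epsilon>\<^sup>2 < 4 \<delta> s \<alpha>(s)\<close>.\<close>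

section \<open>The potential\<close>

definition phi :: "real \<Rightarrow> real \<Rightarrow> real" where
  "phi s u = - s * u + u / (s - u) + u\<^sup>2 / 2"

text \<open>The antiderivative of \<open>phi s\<close> that vanishes at \<open>0\<close>, so that a
  profile leaving the saddle starts with energy zero.\<close>

definition Phi :: "real \<Rightarrow> real \<Rightarrow> real" where
  "Phi s u = - s * u\<^sup>2 / 2 - u - s * ln (1 - u / s) + u ^ 3 / 6"

lemma u_plus_less: "u_plus s < s"
proof -
  have "sqrt (s\<^sup>2) < sqrt (s\<^sup>2 + 8)"
    by (rule real_sqrt_less_mono) simp
  then have "s < sqrt (s\<^sup>2 + 8)" by simp
  then show ?thesis by (simp add: u_plus_def)
qed

lemma u_plus_pos:
  assumes "s > 1" shows "u_plus s > 0"
proof -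
  have "1 < s\<^sup>2" using assms by (simp add: one_less_power)
  then have "s\<^sup>2 + 8 < (3 * s)\<^sup>2" by (simp add: power_mult_distrib)
  then have "sqrt (s\<^sup>2 + 8) < 3 * s"
    using assms by (intro real_less_lsqrt) auto
  then show ?thesis by (simp add: u_plus_def)
qed

text \<open>With \<open>d = s - u\<close>, a nonzero root of \<open>phi s\<close> satisfies
  \<open>1 / d = (s + d) / 2\<close>. This is that equation cleared of denominators; the
  factorization of \<open>phi\<close> and the momentum balance of the shock rest on it.\<close>

lemma u_plus_quadratic: "(s - u_plus s)\<^sup>2 + s * (s - u_plus s) = 2"
proof -
  have "(sqrt (s\<^sup>2 + 8))\<^sup>2 = s\<^sup>2 + 8" by (simp add: add_nonneg_nonneg)
  then show ?thesis
    by (simp add: u_plus_def power2_eq_square field_simps)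
qed

lemma inverse_s_minus_u_plus: "1 / (s - u_plus s) = s - u_plus s / 2"
  using u_plus_quadratic[of s] u_plus_less[of s]
  by (simp add: field_simps power2_eq_square)

lemma s_minus_u_plus_less_one:
  assumes "s > 1" shows "s - u_plus s < 1"
proof (rule ccontr)
  assume "\<not> ?thesis"
  then have d: "s - u_plus s \<ge> 1" by simp
  have "(s - u_plus s)\<^sup>2 \<ge> 1" using d by (simp add: one_le_power)
  moreover have "s * (s - u_plus s) \<ge> s * 1" using d assms by (intro mult_left_mono) auto
  ultimately show False using u_plus_quadratic[of s] assms by linarith
qed

text \<open>The zeros \<open>0\<close> and \<open>u_plus s\<close> are pulled out. For
  \<open>u < s\<close> the remaining factor exceeds \<open>1 / 2\<close>, so the sign of
  \<open>phi\<close> and its lower bounds can be read off.\<close>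

lemma phi_factor:
  assumes "u < s"
  shows "phi s u = (u - u_plus s) * (u * (1 / ((s - u) * (s - u_plus s)) + 1 / 2))"
proof -
  define d where "d = s - u_plus s"
  have d: "d > 0" "u_plus s = s - d" using u_plus_less[of s] by (auto simp: d_def)
  have q: "1 / d = s - (s - d) / 2" using inverse_s_minus_u_plus[of s] by (simp add: d_def)
  have ne: "s - u \<noteq> 0" using assms by simp
  have "(u - (s - d)) * (1 / ((s - u) * d)) = 1 / (s - u) - 1 / d"
    using d ne by (simp add: field_simps)
  moreover have "(u - (s - d)) * (u * (X + 1 / 2)) = u * ((u - (s - d)) * X) + u * (u - (s - d)) / 2" for X
    by (simp add: algebra_simps)
  ultimately have "(u - (s - d)) * (u * (1 / ((s - u) * d) + 1 / 2))
      = u * (1 / (s - u) - 1 / d) + u * (u - (s - d)) / 2"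
    by presburger
  also have "\<dots> = phi s u"
    unfolding q phi_def by (simp add: algebra_simps power2_eq_square add_divide_distrib diff_divide_distrib)
  finally show ?thesis by (simp add: d_def)
qed

lemma Phi_0 [simp]: "Phi s 0 = 0"
  by (simp add: Phi_def)

lemma Phi_deriv:
  assumes "s > 0" "u < s"
  shows "(Phi s has_real_derivative phi s u) (at u)"
proof -
  have pos: "1 - u / s > 0" using assms by simp
  have eq: "s * (1 - u / s) = s - u" using assms by (simp add: field_simps)
  have "(Phi s has_real_derivative
      (- s * u - 1 - s * (- (1 / s) / (1 - u / s)) + u\<^sup>2 / 2)) (at u)"
    unfolding Phi_def[abs_def] using pos
    by (auto intro!: derivative_eq_intros)
  moreover have "- s * u - 1 - s * (- (1 / s) / (1 - u / s)) + u\<^sup>2 / 2 = phi s u"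
    unfolding phi_def using assms eq by (simp add: field_simps)
  ultimately show ?thesis by simp
qed

lemma phi_pos_neg:
  assumes "s > 1" "u < 0" shows "phi s u > 0"
proof -
  have "0 < 1 / ((s - u) * (s - u_plus s)) + 1 / 2"
    using assms u_plus_less[of s] by (intro add_pos_pos divide_pos_pos mult_pos_pos) auto
  then have "u * (1 / ((s - u) * (s - u_plus s)) + 1 / 2) < 0"
    using assms by (intro mult_neg_pos)
  then show ?thesis
    using assms u_plus_pos[of s] by (subst phi_factor) (auto intro!: mult_neg_neg)
qed

lemma phi_times_ge:
  assumes "0 \<le> u" "u < s"
  shows "phi s u * (u - u_plus s) \<ge> u * (u - u_plus s)\<^sup>2 / 2"
proof -
  have "0 \<le> 1 / ((s - u) * (s - u_plus s))"
    using assms u_plus_less[of s] by simp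
  then have "u * (u - u_plus s)\<^sup>2 * (1 / 2) \<le> u * (u - u_plus s)\<^sup>2 * (1 / ((s - u) * (s - u_plus s)) + 1 / 2)"
    using assms by (intro mult_left_mono) auto
  then show ?thesis
    using assms by (subst phi_factor) (auto simp: power2_eq_square mult_ac)
qed

lemma phi_neg_between:
  assumes "0 < u" "u < u_plus s" shows "phi s u < 0"
proof -
  have us: "u < s" using assms u_plus_less[of s] by simp
  have "0 < u * (u - u_plus s)\<^sup>2 / 2" using assms by simp
  also have "\<dots> \<le> phi s u * (u - u_plus s)" using phi_times_ge[of u s] assms us by simp
  finally have "phi s u * (u - u_plus s) > 0" .
  then show ?thesis using assms by (simp add: zero_less_mult_iff)
qed

lemma phi_nonneg_above:
  assumes "u_plus s \<le> u" "u < s" "s > 1" shows "phi s u \<ge> 0"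
proof -
  have u0: "0 \<le> u" using assms u_plus_pos[of s] by simp
  show ?thesis
    using assms u0 u_plus_less[of s] by (subst phi_factor) (auto intro!: mult_nonneg_nonneg add_nonneg_nonneg)
qed

lemma phi_le_linear:
  assumes "0 \<le> u" "u \<le> u_plus s / 2" "s > 1"
  shows "phi s u \<le> - (u_plus s / 4) * u"
proof -
  have us: "u < s" and up: "u_plus s > 0" using assms u_plus_less[of s] u_plus_pos[of s] by auto
  let ?q = "1 / ((s - u) * (s - u_plus s)) + 1 / 2"
  have "?q \<ge> 1 / 2" using us u_plus_less[of s] by simp
  then have "(u_plus s / 2) * (1 / 2) \<le> (u_plus s - u) * ?q"
    using assms up by (intro mult_mono) auto
  then have "u * ((u_plus s / 2) * (1 / 2)) \<le> u * ((u_plus s - u) * ?q)"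
    using assms(1) by (rule mult_left_mono)
  moreover have "(u - p) * (u * q) = - (u * ((p - u) * q))" for p q
    by (simp add: algebra_simps)
  then have "phi s u = - (u * ((u_plus s - u) * ?q))"
    unfolding phi_factor[OF us] .
  moreover have "u * ((u_plus s / 2) * (1 / 2)) = u_plus s / 4 * u" by simp
  ultimately show ?thesis by linarith
qed

text \<open>Follows from \<open>ln x <= x - 1\<close>. It limits how negative the energy can be near
  the saddle: \<open>V\<close> cannot be small compared with \<open>sqrt (- E)\<close>.\<close>

lemma Phi_ge_square:
  assumes "0 \<le> u" "u < s" shows "Phi s u \<ge> - s * u\<^sup>2 / 2"
proof -
  have s: "s > 0" using assms by simp
  have "ln (1 - u / s) \<le> (1 - u / s) - 1"
    using assms s by (intro ln_le_minus_one) simp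
  then have "s * ln (1 - u / s) \<le> s * (- (u / s))"
    using s by (intro mult_left_mono) auto
  then have "s * ln (1 - u / s) \<le> - u" using s by simp
  moreover have "0 \<le> u ^ 3 / 6" using assms by simp
  ultimately show ?thesis unfolding Phi_def by linarith
qed

lemma Phi_decreasing:
  assumes "0 \<le> u" "u < v" "v \<le> u_plus s" "s > 1" shows "Phi s v < Phi s u"
proof (rule DERIV_neg_imp_decreasing_open[OF assms(2)])
  fix x assume x: "u < x" "x < v"
  have "x < s" using x assms u_plus_less[of s] by simp
  moreover have "phi s x < 0" using x assms by (intro phi_neg_between) auto
  ultimately show "\<exists>y. (Phi s has_real_derivative y) (at x) \<and> y < 0"
    using Phi_deriv[of s x] assms by auto
next
  show "continuous_on {u..v} (Phi s)"
    by (rule DERIV_continuous_on[where D = "phi s"])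
       (use assms u_plus_less[of s] in \<open>auto intro!: DERIV_subset[OF Phi_deriv]\<close>)
qed

lemma Phi_minimum:
  assumes "0 \<le> u" "u < s" "s > 1" shows "Phi s (u_plus s) \<le> Phi s u"
proof (cases "u < u_plus s")
  case True
  then show ?thesis using Phi_decreasing[of u "u_plus s" s] assms by simp
next
  case False
  show ?thesis
  proof (rule DERIV_nonneg_imp_nondecreasing[where f = "Phi s"])
    show "u_plus s \<le> u" using False by simp
    fix x assume "u_plus s \<le> x" "x \<le> u"
    then show "\<exists>y. (Phi s has_real_derivative y) (at x) \<and> y \<ge> 0"
      using Phi_deriv[of s x] phi_nonneg_above[of s x] assms by auto
  qed
qed

text \<open>The logarithm makes \<open>Phi\<close> blow up at \<open>u = s\<close>, so a nonpositive
  value keeps \<open>u\<close> away from \<open>s\<close>. The distance depends on \<open>s\<close>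
  alone, hence is uniform in \<epsilon> and \<delta>.\<close>

lemma Phi_nonpos_imp_away:
  assumes "0 \<le> u" "u < s" "Phi s u \<le> 0"
  shows "s * exp (- (s\<^sup>2 / 2 + 1)) \<le> s - u"
proof -
  have s: "s > 0" using assms by simp
  have "u\<^sup>2 \<le> s\<^sup>2" using assms by (intro power_mono) auto
  then have "s * u\<^sup>2 \<le> s * s\<^sup>2" using s by simp
  moreover have "0 \<le> u ^ 3 / 6" using assms by simp
  moreover have "- s * u\<^sup>2 / 2 = - (s * u\<^sup>2) / 2" "s * (s\<^sup>2 / 2 + 1) = s * s\<^sup>2 / 2 + s"
    by (auto simp: algebra_simps)
  ultimately have "- (s * (s\<^sup>2 / 2 + 1)) \<le> s * ln (1 - u / s)"
    using assms unfolding Phi_def by linarith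
  then have "s * - (s\<^sup>2 / 2 + 1) \<le> s * ln (1 - u / s)" by (simp only: mult_minus_right)
  then have "- (s\<^sup>2 / 2 + 1) \<le> ln (1 - u / s)" using s by (simp only: mult_le_cancel_left_pos)
  then have "exp (- (s\<^sup>2 / 2 + 1)) \<le> 1 - u / s"
    using assms s by (subst (asm) ln_ge_iff) auto
  then have "s * exp (- (s\<^sup>2 / 2 + 1)) \<le> s * (1 - u / s)"
    using s by (intro mult_left_mono) auto
  then show ?thesis using s by (simp add: algebra_simps)
qed

text \<open>The right-hand side is the cofactor of \<open>u - u_plus s\<close> in
  \<open>phi_factor\<close> at \<open>u = u_plus s\<close>, that is, the slope of
  \<open>phi s\<close> at the rear state.\<close>

lemma alpha_eq:
  "alpha s = u_plus s * (1 / ((s - u_plus s) * (s - u_plus s)) + 1 / 2)"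
proof -
  define d where "d = s - u_plus s"
  have d: "d > 0" "u_plus s = s - d" using u_plus_less[of s] by (auto simp: d_def)
  have sq: "s - sqrt (s\<^sup>2 + 8) = - 2 * d" by (simp add: d_def u_plus_def field_simps)
  have q: "d\<^sup>2 + s * d = 2" using u_plus_quadratic[of s] by (simp add: d_def)
  have "alpha s = - d + s / d\<^sup>2"
    unfolding alpha_def sq by (simp add: power_mult_distrib)
  also have "\<dots> = (s - d) * (1 / (d * d) + 1 / 2)"
  proof -
    have "(- d + s / d\<^sup>2) * (d * d) = s - d * (d * d)"
      using d by (simp add: field_simps power2_eq_square)
    moreover have "(s - d) * (1 / (d * d) + 1 / 2) * (d * d) = (s - d) + (s - d) * (d * d) / 2"
      using d by (simp add: field_simps)
    moreover have "(s - d * (d * d)) - ((s - d) + (s - d) * (d * d) / 2) = d * (2 - (d\<^sup>2 + s * d)) / 2"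
      by (simp add: field_simps power2_eq_square)
    then have "s - d * (d * d) = (s - d) + (s - d) * (d * d) / 2" using q by simp
    ultimately have "(- d + s / d\<^sup>2) * (d * d) = (s - d) * (1 / (d * d) + 1 / 2) * (d * d)" by simp
    moreover have "d * d \<noteq> 0" using d by simp
    ultimately show ?thesis by (metis mult_right_cancel)
  qed
  finally show ?thesis by (simp add: d_def)
qed

section \<open>The limiting shock\<close>

lemma half_line_integral_below:
  fixes f f' :: "real \<Rightarrow> real"
  assumes deriv: "\<And>x. (f has_real_derivative f' x) (at x)" and cont: "\<And>x. isCont f' x"
    and zero: "\<And>x. x < r \<Longrightarrow> f x = 0" "\<And>x. x < r \<Longrightarrow> f' x = 0"
  shows "(\<integral>x. indicator {..<c} x * f' x \<partial>lborel) = f c"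
proof -
  \<comment> \<open>A point strictly left of \<open>r\<close>, where \<open>f\<close> vanishes, and
    not beyond \<open>c\<close>, so that the fundamental theorem applies on
    \<open>{a..c}\<close>.\<close>
  define a where "a = min (r - 1) c"
  have "(\<integral>x. indicator {..<c} x * f' x \<partial>lborel) = (\<integral>x. f' x * indicator {a..c} x \<partial>lborel)"
  proof (rule integral_cong_AE)
    show "(\<lambda>x. indicator {..<c} x * f' x) \<in> borel_measurable lborel"
      "(\<lambda>x. f' x * indicator {a..c} x) \<in> borel_measurable lborel"
      using borel_measurable_continuous_onI[of f'] cont
      by (auto simp: continuous_on_eq_continuous_at intro!: borel_measurable_times)
    show "AE x in lborel. indicator {..<c} x * f' x = f' x * indicator {a..c} x"
      using AE_lborel_singleton[of c]
      by eventually_elim (auto simp: indicator_def a_def zero)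
  qed
  also have "\<dots> = f c - f a"
    using deriv cont by (intro integral_FTC_Icc_real) (auto simp: a_def)
  also have "f a = 0" by (rule zero) (simp add: a_def)
  finally show ?thesis by simp
qed

lemma half_line_integral_above:
  fixes f f' :: "real \<Rightarrow> real"
  assumes deriv: "\<And>x. (f has_real_derivative f' x) (at x)" and cont: "\<And>x. isCont f' x"
    and zero: "\<And>x. x > r \<Longrightarrow> f x = 0" "\<And>x. x > r \<Longrightarrow> f' x = 0"
  shows "(\<integral>x. indicator {c<..} x * f' x \<partial>lborel) = - f c"
proof -
  have "(\<integral>x. indicator {c<..} x * f' x \<partial>lborel) = (\<integral>x. indicator {..<- c} x * f' (- x) \<partial>lborel)"
    by (subst lborel_integral_real_affine[of "-1" _ 0])
       (auto intro!: Bochner_Integration.integral_cong simp: indicator_def)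
  also have "\<dots> = - (\<integral>x. indicator {..<- c} x * - f' (- x) \<partial>lborel)" by simp
  also have "(\<integral>x. indicator {..<- c} x * - f' (- x) \<partial>lborel) = f (- (- c))"
  proof (rule half_line_integral_below[of "\<lambda>x. f (- x)" _ "- r"])
    show "((\<lambda>x. f (- x)) has_real_derivative - f' (- x)) (at x)" for x
      using deriv DERIV_mirror by blast
    show "isCont (\<lambda>x. - f' (- x)) x" for x
      using cont by (intro continuous_intros isCont_o2[where g = f' and f = uminus]) auto
  qed (use zero in auto)
  finally show ?thesis by simp
qed

lemma test_function_support:
  assumes "test_function \<psi>"
  obtains R where "R > 0"
    "\<And>x t. R < \<bar>x\<bar> \<or> R < \<bar>t\<bar> \<Longrightarrow> \<psi> x t = 0 \<and> Dx \<psi> x t = 0 \<and> Dt \<psi> x t = 0"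
proof -
  obtain K where K: "compact K" "\<And>x t. (x, t) \<notin> K \<Longrightarrow> \<psi> x t = 0"
    using assms by (auto simp: test_function_def)
  obtain R where R: "R > 0" "\<And>p. p \<in> K \<Longrightarrow> norm p \<le> R"
    using compact_imp_bounded[OF K(1)] by (auto simp: bounded_pos)
  have \<psi>0: "\<psi> x t = 0" if "R < \<bar>x\<bar> \<or> R < \<bar>t\<bar>" for x t
  proof (rule K(2))
    have "\<bar>x\<bar> \<le> norm (x, t)" "\<bar>t\<bar> \<le> norm (x, t)"
      using norm_fst_le[of x t] norm_snd_le[of t x] by auto
    then show "(x, t) \<notin> K" using R(2)[of "(x, t)"] that by auto
  qed
  have ev: "\<forall>\<^sub>F y in nhds x. R < \<bar>y\<bar>" if "R < \<bar>x\<bar>" for x :: real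
    using that by (intro order_tendstoD(1)[of "\<lambda>y. \<bar>y\<bar>" "\<bar>x\<bar>"] tendsto_rabs filterlim_ident)
  have D0: "deriv f x = 0" if "\<forall>\<^sub>F y in nhds x. f y = 0" for f :: "real \<Rightarrow> real" and x
    using deriv_cong_ev[of f "\<lambda>_. 0" x x] that by simp
  have "Dx \<psi> x t = 0" if "R < \<bar>x\<bar> \<or> R < \<bar>t\<bar>" for x t
    unfolding Dx_def
  proof (rule D0)
    show "\<forall>\<^sub>F y in nhds x. \<psi> y t = 0"
      using that
    proof
      assume "R < \<bar>x\<bar>"
      from ev[OF this] show ?thesis by eventually_elim (simp add: \<psi>0)
    next
      assume "R < \<bar>t\<bar>"
      then show ?thesis using \<psi>0 by (intro always_eventually) auto
    qed
  qed
  moreover have "Dt \<psi> x t = 0" if "R < \<bar>x\<bar> \<or> R < \<bar>t\<bar>" for x t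
    unfolding Dt_def
  proof (rule D0)
    show "\<forall>\<^sub>F r in nhds t. \<psi> x r = 0"
      using that
    proof
      assume "R < \<bar>x\<bar>"
      then show ?thesis using \<psi>0 by (intro always_eventually) auto
    next
      assume "R < \<bar>t\<bar>"
      from ev[OF this] show ?thesis by eventually_elim (simp add: \<psi>0)
    qed
  qed
  ultimately show ?thesis using R(1) \<psi>0 by (intro that[of R]) auto
qed

lemma integrable_half_plane:
  fixes f :: "real \<Rightarrow> real \<Rightarrow> real"
  assumes cont: "continuous_on UNIV (\<lambda>(x, t). f x t)"
    and zero: "\<And>x t. R < \<bar>x\<bar> \<or> R < \<bar>t\<bar> \<Longrightarrow> f x t = 0"
  shows "integrable (lborel \<Otimes>\<^sub>M lborel) (\<lambda>(x, t). of_bool (x < s * t) * f x t)"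
proof -
  let ?S = "cbox (- R, - R) (R, R)"
  have "integrable lborel (\<lambda>p. indicator ?S p *\<^sub>R (case p of (x, t) \<Rightarrow> f x t))"
    by (intro borel_integrable_compact compact_cbox continuous_on_subset[OF cont]) auto
  moreover have "indicator ?S p *\<^sub>R (case p of (x, t) \<Rightarrow> f x t) = (case p of (x, t) \<Rightarrow> f x t)" for p
  proof (cases p)
    case (Pair x t)
    show ?thesis
    proof (cases "R < \<bar>x\<bar> \<or> R < \<bar>t\<bar>")
      case False
      then have "p \<in> ?S" by (auto simp: Pair cbox_Pair_eq abs_le_iff)
      then show ?thesis by simp
    qed (simp add: Pair zero)
  qed
  ultimately have int: "integrable lborel (\<lambda>(x, t). f x t)" by (simp only:)
  have "open {p. fst p < s * snd p}"
    by (intro open_Collect_less continuous_intros)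
  then have "{p. fst p < s * snd p} \<in> sets lborel" by simp
  from integrable_mult_indicator[OF this int]
  show ?thesis
    unfolding lborel_prod by (simp add: indicator_def case_prod_beta')
qed

text \<open>Divergence theorem for \<open>x < s * t\<close>. By Fubini, \<open>Dx\<close> is
  integrated first in \<open>x\<close>, and \<open>Dt\<close> first in \<open>t\<close> over
  \<open>t > x / s\<close>. The substitution \<open>x = s * t\<close> turns the second boundary term
  into the first one times \<open>- s\<close>.\<close>

lemma half_plane_integrals:
  assumes \<psi>: "test_function \<psi>" and s: "s > 0"
  shows "has_bochner_integral lborel (\<lambda>(x, t). of_bool (x < s * t) * Dx \<psi> x t)
      (\<integral>t. \<psi> (s * t) t \<partial>lborel)" (is "has_bochner_integral _ ?fx ?J")
    and "has_bochner_integral lborel (\<lambda>(x, t). of_bool (x < s * t) * Dt \<psi> x t)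
      (- s * (\<integral>t. \<psi> (s * t) t \<partial>lborel))" (is "has_bochner_integral _ ?ft _")
proof -
  obtain R where R: "R > 0"
    "\<And>x t. R < \<bar>x\<bar> \<or> R < \<bar>t\<bar> \<Longrightarrow> \<psi> x t = 0 \<and> Dx \<psi> x t = 0 \<and> Dt \<psi> x t = 0"
    by (rule test_function_support[OF \<psi>]) (rule that)
  have cx: "continuous_on UNIV (\<lambda>(x, t). Dx \<psi> x t)" and ct: "continuous_on UNIV (\<lambda>(x, t). Dt \<psi> x t)"
    using \<psi> by (auto simp: test_function_def)
  have "continuous_on UNIV (\<lambda>x::real. (x, t))" for t :: real by (intro continuous_intros)
  from continuous_on_compose2[OF cx this] have "continuous_on UNIV (\<lambda>x. Dx \<psi> x t)" for t by simp
  then have cx1: "isCont (\<lambda>x. Dx \<psi> x t) x" for x t by (auto simp: continuous_on_eq_continuous_at)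
  have "continuous_on UNIV (\<lambda>t::real. (x, t))" for x :: real by (intro continuous_intros)
  from continuous_on_compose2[OF ct this] have "continuous_on UNIV (\<lambda>t. Dt \<psi> x t)" for x by simp
  then have ct1: "isCont (\<lambda>t. Dt \<psi> x t) t" for x t by (auto simp: continuous_on_eq_continuous_at)
  have dx: "((\<lambda>x. \<psi> x t) has_real_derivative Dx \<psi> x t) (at x)" for x t
    using \<psi> by (auto simp: test_function_def x_differentiable_def Dx_def field_differentiable_derivI)
  have dt: "((\<lambda>t. \<psi> x t) has_real_derivative Dt \<psi> x t) (at t)" for x t
    using \<psi> by (auto simp: test_function_def t_differentiable_def Dt_def field_differentiable_derivI)
  have ix: "integrable (lborel \<Otimes>\<^sub>M lborel) ?fx" and it: "integrable (lborel \<Otimes>\<^sub>M lborel) ?ft"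
    using R(2) by (auto intro!: integrable_half_plane[OF cx, of R] integrable_half_plane[OF ct, of R])
  have "integral\<^sup>L (lborel \<Otimes>\<^sub>M lborel) ?fx = (\<integral>t. (\<integral>x. of_bool (x < s * t) * Dx \<psi> x t \<partial>lborel) \<partial>lborel)"
    using lborel_pair.integral_snd[OF ix] by simp
  also have "(\<lambda>t. \<integral>x. of_bool (x < s * t) * Dx \<psi> x t \<partial>lborel) = (\<lambda>t. \<psi> (s * t) t)"
  proof
    fix t
    have "(\<integral>x. indicator {..<s * t} x * Dx \<psi> x t \<partial>lborel) = \<psi> (s * t) t"
      by (rule half_line_integral_below[of "\<lambda>x. \<psi> x t" _ "- R", OF dx cx1]) (use R in auto)
    then show "(\<integral>x. of_bool (x < s * t) * Dx \<psi> x t \<partial>lborel) = \<psi> (s * t) t"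
      by (simp add: indicator_def)
  qed
  finally show "has_bochner_integral lborel ?fx ?J"
    using ix by (simp add: has_bochner_integral_iff lborel_prod)
  have "integral\<^sup>L (lborel \<Otimes>\<^sub>M lborel) ?ft = (\<integral>x. (\<integral>t. of_bool (x < s * t) * Dt \<psi> x t \<partial>lborel) \<partial>lborel)"
    using lborel_pair.integral_fst[OF it] by simp
  also have "(\<lambda>x. \<integral>t. of_bool (x < s * t) * Dt \<psi> x t \<partial>lborel) = (\<lambda>x. - \<psi> x (x / s))"
  proof
    fix x
    have "(\<integral>t. indicator {x / s<..} t * Dt \<psi> x t \<partial>lborel) = - \<psi> x (x / s)"
      by (rule half_line_integral_above[of "\<lambda>t. \<psi> x t" _ R, OF dt ct1]) (use R in auto)
    moreover have "x / s < t \<longleftrightarrow> x < s * t" for t using s by (simp add: field_simps)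
    ultimately show "(\<integral>t. of_bool (x < s * t) * Dt \<psi> x t \<partial>lborel) = - \<psi> x (x / s)"
      by (simp add: indicator_def)
  qed
  also have "(\<integral>x. - \<psi> x (x / s) \<partial>lborel) = s * (\<integral>t. - \<psi> (s * t) t \<partial>lborel)"
    using s by (subst lborel_integral_real_affine[of s _ 0]) auto
  finally show "has_bochner_integral lborel ?ft (- s * ?J)"
    using it by (simp add: has_bochner_integral_iff lborel_prod)
qed

text \<open>The state ahead of the shock is zero, so every weak form reduces to these two integrals.
  With density jump \<open>a\<close> and flux jump \<open>b\<close>, the coefficient
  \<open>b - s * a\<close> is the Rankine-Hugoniot defect.\<close>

lemma half_plane_combination:
  assumes "test_function \<psi>" "s > 0"
    and "\<And>x t. f x t = a * (of_bool (x < s * t) * Dt \<psi> x t) + b * (of_bool (x < s * t) * Dx \<psi> x t)"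
  shows "has_bochner_integral lborel (\<lambda>(x, t). f x t) ((b - s * a) * (\<integral>t. \<psi> (s * t) t \<partial>lborel))"
proof -
  note J = half_plane_integrals[OF assms(1,2)]
  have "has_bochner_integral lborel
      (\<lambda>p. a * (case p of (x, t) \<Rightarrow> of_bool (x < s * t) * Dt \<psi> x t)
         + b * (case p of (x, t) \<Rightarrow> of_bool (x < s * t) * Dx \<psi> x t))
      (a * (- s * (\<integral>t. \<psi> (s * t) t \<partial>lborel)) + b * (\<integral>t. \<psi> (s * t) t \<partial>lborel))"
    by (intro has_bochner_integral_add has_bochner_integral_mult_right J)
  then show ?thesis
    unfolding assms(3) by (simp add: case_prod_beta' algebra_simps)
qed

lemma entropic_shock:
  assumes s: "s > 1"
  shows "entropic_shock_wave s (h_plus s, u_plus s) (0, 0)"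
proof -
  define u h d where "u = u_plus s" and "h = h_plus s" and "d = s - u_plus s"
  have u: "u > 0" and d: "d > 0" "d < 1" and q: "d\<^sup>2 + s * d = 2" and su: "u = s - d"
    using u_plus_pos[OF s] u_plus_less[of s] s_minus_u_plus_less_one[OF s] u_plus_quadratic[of s]
    by (auto simp: u_def d_def)
  have h: "h = u / d" by (simp add: h_def h_plus_def u_def d_def)
  have hpos: "h > 0" using u d h by simp
  have h1: "1 + h = s / d" using d by (simp add: h su field_simps)
  have mass: "u + h * u = s * h"
    using d by (simp add: h su field_simps)
  have momentum: "h + u\<^sup>2 / 2 = s * u"
  proof -
    have "1 / d = s - u / 2" using inverse_s_minus_u_plus[of s] by (simp add: u_def d_def)
    moreover have "h = u * (1 / d)" by (simp add: h)
    ultimately have "h = u * (s - u / 2)" by simp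
    then show ?thesis by (simp add: algebra_simps power2_eq_square)
  qed
  have sd: "s * d \<ge> 1"
  proof -
    have "d\<^sup>2 \<le> 1" using d by (simp add: power_le_one)
    then show ?thesis using q by simp
  qed
  \<comment> \<open>The defect of the energy is a positive multiple of \<open>s * d - 1\<close>,
    which is nonnegative because \<open>d < 1\<close> and \<open>d^2 + s * d = 2\<close>.\<close>
  have production: "swe_energy_flux h u - s * swe_energy h u \<ge> 0"
  proof -
    have "swe_energy_flux h u - s * swe_energy h u = s * h * (s * u) - s * (h\<^sup>2 / 2 + s / d * u\<^sup>2 / 2)"
      by (simp add: swe_energy_flux_def swe_energy_def mass momentum h1)
    also have "\<dots> = s * u\<^sup>2 / (2 * d\<^sup>2) * (s * d - 1)"
      using d by (simp add: h field_simps power2_eq_square)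
    finally show ?thesis using s d sd by simp
  qed
  have weak: "swe_weak_solution (jump s h 0) (jump s u 0)"
    unfolding swe_weak_solution_def
  proof (intro allI impI conjI)
    fix \<psi> assume \<psi>: "test_function \<psi>"
    have "has_bochner_integral lborel (\<lambda>(x, t). jump s h 0 x t * Dt \<psi> x t
        + (jump s u 0 x t + jump s h 0 x t * jump s u 0 x t) * Dx \<psi> x t)
        (((u + h * u) - s * h) * (\<integral>t. \<psi> (s * t) t \<partial>lborel))"
      by (rule half_plane_combination[OF \<psi>]) (use s in \<open>auto simp: jump_def\<close>)
    then show "has_bochner_integral lborel (\<lambda>(x, t). jump s h 0 x t * Dt \<psi> x t
        + (jump s u 0 x t + jump s h 0 x t * jump s u 0 x t) * Dx \<psi> x t) 0"
      by (simp add: mass)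
    have "has_bochner_integral lborel (\<lambda>(x, t). jump s u 0 x t * Dt \<psi> x t
        + (jump s h 0 x t + (jump s u 0 x t)\<^sup>2 / 2) * Dx \<psi> x t)
        (((h + u\<^sup>2 / 2) - s * u) * (\<integral>t. \<psi> (s * t) t \<partial>lborel))"
      by (rule half_plane_combination[OF \<psi>]) (use s in \<open>auto simp: jump_def\<close>)
    then show "has_bochner_integral lborel (\<lambda>(x, t). jump s u 0 x t * Dt \<psi> x t
        + (jump s h 0 x t + (jump s u 0 x t)\<^sup>2 / 2) * Dx \<psi> x t) 0"
      by (simp add: momentum)
  qed
  have energy: "swe_energy_inequality (jump s h 0) (jump s u 0)"
    unfolding swe_energy_inequality_def
  proof (intro allI impI)
    fix \<psi> :: "real \<Rightarrow> real \<Rightarrow> real" assume \<psi>: "test_function \<psi> \<and> (\<forall>x t. \<psi> x t \<ge> 0)"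
    then have t: "test_function \<psi>" by simp
    have "has_bochner_integral lborel (\<lambda>(x, t). swe_energy (jump s h 0 x t) (jump s u 0 x t) * Dt \<psi> x t
        + swe_energy_flux (jump s h 0 x t) (jump s u 0 x t) * Dx \<psi> x t)
        ((swe_energy_flux h u - s * swe_energy h u) * (\<integral>t. \<psi> (s * t) t \<partial>lborel))"
      by (rule half_plane_combination[OF t])
         (use s in \<open>auto simp: jump_def swe_energy_def swe_energy_flux_def\<close>)
    moreover have "0 \<le> (\<integral>t. \<psi> (s * t) t \<partial>lborel)"
      using \<psi> by (intro Bochner_Integration.integral_nonneg) auto
    ultimately show "\<exists>I\<ge>0. has_bochner_integral lborel
        (\<lambda>(x, t). swe_energy (jump s h 0 x t) (jump s u 0 x t) * Dt \<psi> x t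
          + swe_energy_flux (jump s h 0 x t) (jump s u 0 x t) * Dx \<psi> x t) I"
      using production by (intro exI conjI) (rule mult_nonneg_nonneg)
  qed
  \<comment> \<open>A shock of the second family: ahead the speed is \<open>1 < s\<close>; behind,
    \<open>s < u + sqrt (1 + h)\<close> amounts to \<open>d^3 < s\<close>, clear from
    \<open>d < 1 < s\<close>.\<close>
  have "lax_condition s (h, u) (0, 0)"
  proof -
    have "d\<^sup>2 * d < 1 * s"
      using d s by (intro mult_strict_mono) (auto simp: power_less_one_iff)
    then have "d\<^sup>2 < s / d" using d by (simp add: pos_less_divide_eq)
    then have "d < sqrt (s / d)" using d by (intro real_less_rsqrt)
    moreover have "0 \<le> sqrt (s / d)" using s d by simp
    ultimately show ?thesis
      using s hpos d su by (auto simp: lax_condition_def char_speed1_def char_speed2_def h1)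
  qed
  then show ?thesis
    using weak energy u unfolding entropic_shock_wave_def u_def h_def by simp
qed

section \<open>Energy and oscillation of a profile\<close>

text \<open>Convergence of \<open>f\<close> does not force \<open>f'\<close> to converge. The mean
  value theorem on \<open>[n, n + 1]\<close> still finds points where \<open>f'\<close> equals a
  vanishing increment of \<open>f\<close>.\<close>

lemma small_derivative_points:
  fixes f f' :: "real \<Rightarrow> real"
  assumes deriv: "\<And>t. (f has_real_derivative f' t) (at t)" and lim: "(f \<longlongrightarrow> l) at_top"
  obtains x :: "nat \<Rightarrow> real"
    where "\<And>n. real n < x n" "\<And>n. x n < real n + 1" "(\<lambda>n. f' (x n)) \<longlonglongrightarrow> 0"
proof -
  have "\<exists>z. real n < z \<and> z < real n + 1 \<and> f (real n + 1) - f (real n) = f' z" for n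
    using MVT2[of "real n" "real n + 1" f f'] deriv by auto
  then obtain x where x: "\<And>n. real n < x n" "\<And>n. x n < real n + 1"
      "\<And>n. f (real n + 1) - f (real n) = f' (x n)"
    by metis
  have 1: "(\<lambda>n. f (real n)) \<longlonglongrightarrow> l"
    by (rule filterlim_compose[OF lim filterlim_real_sequentially])
  have "(\<lambda>n. f (real (Suc n)) - f (real n)) \<longlonglongrightarrow> l - l"
    by (intro tendsto_diff 1 LIMSEQ_Suc[OF 1])
  then have "(\<lambda>n. f' (x n)) \<longlonglongrightarrow> 0"
    using x(3) by (simp add: add.commute)
  with x(1,2) show ?thesis by (rule that)
qed

lemma last_crossing:
  fixes f :: "real \<Rightarrow> real"
  assumes "a \<le> b" "continuous_on {a..b} f" "f a \<le> y" "y \<le> f b"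
  obtains c where "a \<le> c" "c \<le> b" "f c = y" "\<And>t. c \<le> t \<Longrightarrow> t \<le> b \<Longrightarrow> y \<le> f t"
proof -
  define S where "S = {t \<in> {a..b}. f t \<le> y}"
  define c where "c = Sup S"
  have cl: "closed S"
    unfolding S_def using assms(2) by (intro continuous_on_closed_Collect_le) auto
  have bdd: "bdd_above S" by (rule bdd_aboveI[of _ b]) (auto simp: S_def)
  have "a \<in> S" using assms by (auto simp: S_def)
  then have cS: "c \<in> S"
    unfolding c_def using cl bdd by (intro closed_contains_Sup) auto
  have ub: "t \<le> c" if "t \<in> S" for t
    unfolding c_def using that bdd by (rule cSup_upper)
  have cont: "continuous_on {c..b} f"
    by (rule continuous_on_subset[OF assms(2)]) (use cS in \<open>auto simp: S_def\<close>)
  obtain x where x: "c \<le> x" "x \<le> b" "f x = y"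
    using IVT'[of f c y b] cS assms(4) cont by (auto simp: S_def)
  then have "x \<in> S" using cS by (auto simp: S_def)
  then have "f c = y" using ub[of x] x by simp
  moreover have "y \<le> f t" if "c \<le> t" "t \<le> b" for t
  proof (rule ccontr)
    assume "\<not> y \<le> f t"
    then have "t \<in> S" using that cS by (auto simp: S_def)
    then have "t = c" using ub[of t] that by simp
    then show False using \<open>f c = y\<close> \<open>\<not> y \<le> f t\<close> by simp
  qed
  ultimately show ?thesis using cS by (intro that[of c]) (auto simp: S_def)
qed

lemma damped_oscillator_not_eventually_pos:
  fixes z z' q :: "real \<Rightarrow> real"
  assumes z: "\<And>t. (z has_real_derivative z' t) (at t)"
    and z': "\<And>t. (z' has_real_derivative - (\<epsilon> * z' t + q t * z t) / A) (at t)"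
    and q: "(q \<longlongrightarrow> \<alpha>) at_top" and A: "A > 0" and disc: "\<epsilon>\<^sup>2 < 4 * A * \<alpha>"
  shows "\<not> (\<forall>\<^sub>F t in at_top. z t > 0)"
proof
  assume pos: "\<forall>\<^sub>F t in at_top. z t > 0"
  \<comment> \<open>With \<open>y = exp (c t) z\<close> the damping disappears: \<open>y'' = - (q / A - c\<^sup>2) y\<close>, and the bracket
    eventually exceeds a positive constant. A positive concave function on a half-line is
    nondecreasing, so \<open>y''\<close> stays below a negative constant, which is absurd.\<close>
  define c where "c = \<epsilon> / (2 * A)"
  have "A * c\<^sup>2 < \<alpha>"
    using disc A by (simp add: c_def power2_eq_square field_simps)
  then obtain m where m: "A * c\<^sup>2 < m" "m < \<alpha>" using dense by blast
  define \<omega> where "\<omega> = (m - A * c\<^sup>2) / A"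
  have om: "\<omega> > 0" using m A by (simp add: \<omega>_def)
  have "\<forall>\<^sub>F t in at_top. q t > m" using q m(2) by (rule order_tendstoD)
  then have "\<forall>\<^sub>F t in at_top. z t > 0 \<and> q t > m" using pos by eventually_elim simp
  then obtain T where T: "\<And>t. t \<ge> T \<Longrightarrow> z t > 0" "\<And>t. t \<ge> T \<Longrightarrow> q t > m"
    by (auto simp: eventually_at_top_linorder)
  define y where "y = (\<lambda>t. exp (c * t) * z t)"
  define y' where "y' = (\<lambda>t. exp (c * t) * (z' t + c * z t))"
  have dy: "(y has_real_derivative y' t) (at t)" for t
    unfolding y_def y'_def
    by (auto intro!: derivative_eq_intros z simp: algebra_simps)
  have dy': "(y' has_real_derivative - (q t / A - c\<^sup>2) * y t) (at t)" for t
    unfolding y_def y'_def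
    using A by (auto intro!: derivative_eq_intros z z' simp: c_def field_simps power2_eq_square)
  have ypos: "y t > 0" if "t \<ge> T" for t using T(1)[OF that] by (simp add: y_def)
  have rate: "- (q t / A - c\<^sup>2) * y t \<le> - \<omega> * y t" if "t \<ge> T" for t
  proof (rule mult_right_mono)
    have "\<omega> = m / A - c\<^sup>2" using A by (simp add: \<omega>_def field_simps)
    moreover have "m / A \<le> q t / A" using T(2)[OF that] A by (intro divide_right_mono) auto
    ultimately show "- (q t / A - c\<^sup>2) \<le> - \<omega>" by simp
  qed (use ypos[OF that] in simp)
  have y'_dec: "y' r \<le> y' t" if "T \<le> t" "t \<le> r" for t r
  proof (rule DERIV_nonpos_imp_nonincreasing[OF that(2)])
    fix x assume "t \<le> x" "x \<le> r"
    then have x: "x \<ge> T" using that by simp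
    have "\<omega> * y x \<ge> 0" using om ypos[OF x] by simp
    then have "- (q x / A - c\<^sup>2) * y x \<le> 0" using rate[OF x] by simp
    then show "\<exists>d. (y' has_real_derivative d) (at x) \<and> d \<le> 0" using dy' by blast
  qed
  have y'_nonneg: "y' t \<ge> 0" if t: "t \<ge> T" for t
  proof (rule ccontr)
    assume "\<not> y' t \<ge> 0"
    then have neg: "y' t < 0" by simp
    \<comment> \<open>The point where the tangent at \<open>t\<close>, of negative slope, reaches
      zero; concavity keeps \<open>y\<close> below this tangent.\<close>
    define r where "r = t + y t / (- y' t)"
    have r: "t < r" using neg ypos[OF t] by (simp add: r_def divide_pos_neg)
    obtain x where x: "t < x" "y r - y t = (r - t) * y' x"
      using MVT2[of t r y y'] r dy by blast
    have "(r - t) * y' x \<le> (r - t) * y' t"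
      using r x t by (intro mult_left_mono y'_dec) auto
    also have "(r - t) * y' t = - y t" using neg by (simp add: r_def)
    finally have "y r \<le> 0" using x by simp
    then show False using ypos[of r] r t by simp
  qed
  have y_ge: "y t \<ge> y T" if "t \<ge> T" for t
    by (rule DERIV_nonneg_imp_nondecreasing[OF that]) (use dy y'_nonneg in blast)
  \<comment> \<open>Long enough for a decay of \<open>y'\<close> at rate at least
    \<open>\<omega> * y T\<close> to use up \<open>y' T + 1\<close>, which leaves
    \<open>y' r <= - 1\<close>.\<close>
  define r where "r = T + (y' T + 1) / (\<omega> * y T)"
  have r: "T < r" using om ypos[of T] y'_nonneg[of T] by (simp add: r_def)
  obtain x where x: "T < x" "y' r - y' T = (r - T) * (- (q x / A - c\<^sup>2) * y x)"
    using MVT2[of T r y' "\<lambda>x. - (q x / A - c\<^sup>2) * y x"] r dy' by blast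
  have "\<omega> * y T \<le> \<omega> * y x" using om y_ge[of x] x by (intro mult_left_mono) auto
  then have "- (q x / A - c\<^sup>2) * y x \<le> - (\<omega> * y T)" using rate[of x] x by simp
  then have "(r - T) * (- (q x / A - c\<^sup>2) * y x) \<le> (r - T) * (- (\<omega> * y T))"
    using r by (intro mult_left_mono) auto
  also have "\<dots> = - (y' T + 1)" using om ypos[of T] by (simp add: r_def)
  finally have "y' r < 0" using x by simp
  then show False using y'_nonneg[of r] r by simp
qed

text \<open>The profile in the reversed variable \<open>t = - (x - s t)\<close>, with \<open>P = V'\<close> and \<open>A = \<delta> s\<close>; in this
  direction the mechanical energy decreases.\<close>

locale wave_profile =
  fixes s \<epsilon> A :: real and V P :: "real \<Rightarrow> real"
  assumes s: "s > 1" and \<epsilon>: "\<epsilon> > 0" and A: "A > 0"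
    and V_deriv: "\<And>t. (V has_real_derivative P t) (at t)"
    and P_deriv: "\<And>t. (P has_real_derivative - (\<epsilon> * P t + phi s (V t)) / A) (at t)"
    and V_less: "\<And>t. V t < s"
    and V_bot: "(V \<longlongrightarrow> 0) at_bot" and V_top: "(V \<longlongrightarrow> u_plus s) at_top"
begin

lemma u_plus_props: "u_plus s > 0" "u_plus s < s"
  using u_plus_pos[OF s] u_plus_less by auto

lemma V_cont: "continuous_on S V"
  by (rule DERIV_continuous_on[where D = P]) (auto intro: DERIV_subset[OF V_deriv])

definition E :: "real \<Rightarrow> real" where
  "E t = A * (P t)\<^sup>2 / 2 + Phi s (V t)"

lemma E_deriv: "(E has_real_derivative - \<epsilon> * (P t)\<^sup>2) (at t)"
proof -
  have "(Phi s has_real_derivative phi s (V t)) (at (V t))"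
    using s V_less by (intro Phi_deriv) auto
  from DERIV_chain2[OF this V_deriv]
  have "((\<lambda>t. Phi s (V t)) has_real_derivative phi s (V t) * P t) (at t)" .
  then show ?thesis
    unfolding E_def[abs_def]
    using A by (auto intro!: derivative_eq_intros P_deriv simp: field_simps power2_eq_square)
qed

lemma E_antimono:
  assumes "t \<le> r" shows "E r \<le> E t"
  by (rule DERIV_nonpos_imp_nonincreasing[OF assms]) (use E_deriv \<epsilon> in \<open>force\<close>)

lemma V_nonneg: "V t \<ge> 0"
proof (rule ccontr)
  assume "\<not> V t \<ge> 0"
  then have neg: "V t < 0" by simp
  have "\<forall>\<^sub>F r in at_bot. V r > V t" "\<forall>\<^sub>F r in at_top. V r > V t"
    using order_tendstoD(1)[OF V_bot neg] order_tendstoD(1)[OF V_top] neg u_plus_props by auto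
  then obtain a b where a: "\<And>r. r \<le> a \<Longrightarrow> V r > V t" and b: "\<And>r. r \<ge> b \<Longrightarrow> V r > V t"
    by (auto simp: eventually_at_top_linorder eventually_at_bot_linorder)
  \<comment> \<open>Outside \<open>{a..b}\<close> the profile exceeds \<open>V t\<close>, so a
    minimum over this interval is a global one.\<close>
  have tab: "t \<in> {a..b}" using a[of t] b[of t] by force
  then obtain m where m: "m \<in> {a..b}" "\<And>r. r \<in> {a..b} \<Longrightarrow> V m \<le> V r"
    using continuous_attains_inf[of "{a..b}" V] V_cont by auto
  have mt: "V m \<le> V t" using m tab by blast
  have min: "V m \<le> V r" for r
    using m(2)[of r] mt a[of r] b[of r] by (cases "r \<in> {a..b}") force+
  \<comment> \<open>At a negative minimum \<open>A V'' = - phi s V < 0\<close>.\<close>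
  have Pm: "P m = 0"
    using DERIV_local_min[OF V_deriv, of 1 m] min by auto
  have "- (\<epsilon> * P m + phi s (V m)) / A < 0"
    using Pm phi_pos_neg[of s "V m"] s A mt neg by simp
  then obtain d where d: "d > 0" "\<And>h. h > 0 \<Longrightarrow> h < d \<Longrightarrow> P (m + h) < P m"
    using DERIV_neg_dec_right[OF P_deriv] by blast
  obtain x where x: "m < x" "x < m + d / 2" "V (m + d / 2) - V m = (m + d / 2 - m) * P x"
    using MVT2[of m "m + d / 2" V P] d V_deriv by auto
  have "P x < 0" using d(2)[of "x - m"] x Pm by simp
  then have "(m + d / 2 - m) * P x < 0" using d by (simp add: mult_less_0_iff)
  then show False using x min[of "m + d / 2"] by simp
qed

lemma Phi_tendsto_0:
  assumes "(f \<longlongrightarrow> 0) G" shows "((\<lambda>x. Phi s (f x)) \<longlongrightarrow> 0) G"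
proof -
  have "isCont (Phi s) 0" using Phi_deriv[of s 0] s by (auto intro: DERIV_isCont)
  from isCont_tendsto_compose[OF this assms] show ?thesis by simp
qed

text \<open>\<open>E\<close> decreases, so it lies below its values in the far past. Along points
  running to minus infinity with \<open>P\<close> tending to \<open>0\<close>, these values tend to
  \<open>Phi s 0 = 0\<close>.\<close>

lemma E_nonpos: "E t \<le> 0"
proof -
  have d: "((\<lambda>r. V (- r)) has_real_derivative - P (- r)) (at r)" for r
    using DERIV_mirror[of V "P (- r)" r] V_deriv by simp
  have l: "((\<lambda>r. V (- r)) \<longlongrightarrow> 0) at_top"
    using V_bot by (simp add: at_bot_mirror filterlim_filtermap)
  obtain x :: "nat \<Rightarrow> real" where x: "\<And>n. real n < x n" "\<And>n. x n < real n + 1" "(\<lambda>n. - P (- x n)) \<longlonglongrightarrow> 0"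
    by (rule small_derivative_points[OF d l]) (rule that)
  have P0: "(\<lambda>n. P (- x n)) \<longlonglongrightarrow> 0" using tendsto_minus[OF x(3)] by simp
  have xt: "filterlim x at_top sequentially"
    by (rule filterlim_at_top_mono[OF filterlim_real_sequentially]) (intro always_eventually allI less_imp_le x(1))
  have "(\<lambda>n. V (- x n)) \<longlonglongrightarrow> 0" by (rule filterlim_compose[OF l xt])
  then have "(\<lambda>n. A * (P (- x n))\<^sup>2 / 2 + Phi s (V (- x n))) \<longlonglongrightarrow> A * 0\<^sup>2 / 2 + 0"
    by (intro tendsto_intros P0 Phi_tendsto_0) auto
  then have lim: "(\<lambda>n. E (- x n)) \<longlonglongrightarrow> 0" by (simp add: E_def)
  have "\<forall>\<^sub>F n in sequentially. x n \<ge> - t"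
    using xt by (simp add: filterlim_at_top)
  then have "\<forall>\<^sub>F n in sequentially. E t \<le> E (- x n)"
    by eventually_elim (auto intro: E_antimono)
  with lim show ?thesis by (rule tendsto_lowerbound) simp
qed

lemma Phi_V_nonpos: "Phi s (V t) \<le> 0"
proof -
  have "0 \<le> A * (P t)\<^sup>2 / 2" using A by simp
  then show ?thesis using E_nonpos[of t] by (simp add: E_def)
qed

lemma V_away: "s * exp (- (s\<^sup>2 / 2 + 1)) \<le> s - V t"
  using V_nonneg V_less Phi_V_nonpos by (rule Phi_nonpos_imp_away)

lemma kinetic_le: "A * (P t)\<^sup>2 / 2 \<le> - Phi s (u_plus s)"
  using E_nonpos[of t] Phi_minimum[OF V_nonneg V_less s, of t] by (simp add: E_def)

text \<open>The kinetic energy is at most the depth of the well. Multiplied by \<open>A\<close>,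
  this makes \<open>A * P\<close>, a boundary term of the integrated equation, of order
  \<open>sqrt A\<close> uniformly in time.\<close>

lemma momentum_le: "\<bar>A * P t\<bar> \<le> sqrt (2 * A * - Phi s (u_plus s))"
proof (rule real_le_rsqrt)
  have "A * (A * (P t)\<^sup>2 / 2) \<le> A * - Phi s (u_plus s)"
    using kinetic_le A by (intro mult_left_mono) auto
  then show "\<bar>A * P t\<bar>\<^sup>2 \<le> 2 * A * - Phi s (u_plus s)"
    by (simp add: power2_eq_square mult_ac)
qed

lemma Phi_u_plus_neg: "Phi s (u_plus s) < 0"
  using Phi_decreasing[of 0 "u_plus s" s] u_plus_props s by simp

lemma E_greater: "E t > Phi s (u_plus s)"
proof (rule ccontr)
  assume neg: "\<not> E t > Phi s (u_plus s)"
  \<comment> \<open>Backward uniqueness: \<open>D' = - \<epsilon> P\<^sup>2 \<ge> - (2 \<epsilon> / A) D\<close>, so a zero of \<open>D\<close> propagates to the past.\<close>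
  define D where "D = (\<lambda>r. E r - Phi s (u_plus s))"
  have dD: "((\<lambda>r. D r * exp (2 * \<epsilon> / A * r)) has_real_derivative
      exp (2 * \<epsilon> / A * r) * (2 * \<epsilon> / A * (D r - A * (P r)\<^sup>2 / 2))) (at r)" for r
    unfolding D_def using A
    by (auto intro!: derivative_eq_intros E_deriv simp: field_simps)
  have Dge: "D r - A * (P r)\<^sup>2 / 2 \<ge> 0" for r
    using Phi_minimum[OF V_nonneg V_less s, of r] by (simp add: D_def E_def)
  have Dle: "D r \<le> 0" if "r \<le> t" for r
  proof -
    have "D r * exp (2 * \<epsilon> / A * r) \<le> D t * exp (2 * \<epsilon> / A * t)"
    proof (rule DERIV_nonneg_imp_nondecreasing[OF that])
      fix x
      have "exp (2 * \<epsilon> / A * x) * (2 * \<epsilon> / A * (D x - A * (P x)\<^sup>2 / 2)) \<ge> 0"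
        using Dge \<epsilon> A by (intro mult_nonneg_nonneg) auto
      then show "\<exists>y. ((\<lambda>r. D r * exp (2 * \<epsilon> / A * r)) has_real_derivative y) (at x) \<and> 0 \<le> y"
        using dD by blast
    qed
    also have "\<dots> \<le> 0" using neg by (simp add: D_def mult_nonpos_nonneg)
    finally show ?thesis by (simp add: mult_le_0_iff)
  qed
  have "Phi s (V r) \<le> Phi s (u_plus s)" if "r \<le> t" for r
  proof -
    have "0 \<le> A * (P r)\<^sup>2 / 2" using A by simp
    then show ?thesis using Dle[OF that] by (simp add: D_def E_def)
  qed
  then have "\<forall>\<^sub>F r in at_bot. Phi s (V r) \<le> Phi s (u_plus s)"
    by (auto simp: eventually_at_bot_linorder)
  with Phi_tendsto_0[OF V_bot] have "0 \<le> Phi s (u_plus s)"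
    by (rule tendsto_upperbound) simp
  then show False using Phi_u_plus_neg by simp
qed

text \<open>Rest at \<open>u_plus s\<close> would mean the minimal energy, which is never attained.
  So the profile cannot touch the rear state tangentially.\<close>

lemma E_at_rest: "V t = u_plus s \<Longrightarrow> P t \<noteq> 0"
  using E_greater[of t] by (auto simp: E_def)

text \<open>With \<open>z = V - u_plus s\<close> the equation reads
  \<open>A z'' + \<epsilon> z' + q z = 0\<close>, where \<open>q\<close> tends to
  \<open>alpha s\<close>. Both \<open>z\<close> and \<open>- z\<close> solve it, so neither is
  eventually positive. Staying weakly on one side would mean staying strictly there, since a contact
  point would be an extremum with \<open>P = 0\<close>.\<close>

lemma oscillates:
  assumes "\<epsilon>\<^sup>2 < 4 * A * alpha s"
  shows "\<exists>\<^sub>F t in at_top. V t > u_plus s" "\<exists>\<^sub>F t in at_top. V t < u_plus s"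
proof -
  define q where "q = (\<lambda>t. V t * (1 / ((s - V t) * (s - u_plus s)) + 1 / 2))"
  have q: "(q \<longlongrightarrow> alpha s) at_top"
    unfolding q_def alpha_eq using u_plus_props by (intro tendsto_intros V_top) auto
  have phi_q: "phi s (V t) = q t * (V t - u_plus s)" for t
    using phi_factor[OF V_less, of t] by (simp add: q_def)
  have "\<not> (\<forall>\<^sub>F t in at_top. V t - u_plus s > 0)"
  proof (rule damped_oscillator_not_eventually_pos[OF _ _ q A assms])
    show "((\<lambda>t. V t - u_plus s) has_real_derivative P t) (at t)" for t
      by (auto intro!: derivative_eq_intros V_deriv)
    show "(P has_real_derivative - (\<epsilon> * P t + q t * (V t - u_plus s)) / A) (at t)" for t
      using P_deriv[of t] by (simp add: phi_q)
  qed
  moreover have "\<not> (\<forall>\<^sub>F t in at_top. u_plus s - V t > 0)"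
  proof (rule damped_oscillator_not_eventually_pos[OF _ _ q A assms])
    show "((\<lambda>t. u_plus s - V t) has_real_derivative - P t) (at t)" for t
      by (auto intro!: derivative_eq_intros V_deriv)
    have "- (- (\<epsilon> * P t + phi s (V t)) / A) = - (\<epsilon> * - P t + q t * (u_plus s - V t)) / A" for t
      unfolding phi_q using A by (simp add: field_simps)
    then show "((\<lambda>t. - P t) has_real_derivative - (\<epsilon> * - P t + q t * (u_plus s - V t)) / A) (at t)" for t
      using DERIV_minus[OF P_deriv[of t]] by simp
  qed
  moreover have "\<forall>\<^sub>F t in at_top. V t - u_plus s > 0" if ev: "\<forall>\<^sub>F t in at_top. V t \<ge> u_plus s"
  proof -
    obtain N where N: "\<And>t. t \<ge> N \<Longrightarrow> V t \<ge> u_plus s"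
      using ev by (auto simp: eventually_at_top_linorder)
    have "V t \<noteq> u_plus s" if "t > N" for t
    proof
      assume eq: "V t = u_plus s"
      have "P t = 0"
        by (rule DERIV_local_min[OF V_deriv, of "t - N"]) (use that eq N in \<open>auto simp: abs_if split: if_splits\<close>)
      then show False using E_at_rest eq by blast
    qed
    then have "V t - u_plus s > 0" if "t > N" for t using N[of t] that by force
    then show ?thesis by (rule eventually_mono[OF eventually_gt_at_top[of N]])
  qed
  moreover have "\<forall>\<^sub>F t in at_top. u_plus s - V t > 0" if ev: "\<forall>\<^sub>F t in at_top. V t \<le> u_plus s"
  proof -
    obtain N where N: "\<And>t. t \<ge> N \<Longrightarrow> V t \<le> u_plus s"
      using ev by (auto simp: eventually_at_top_linorder)
    have "V t \<noteq> u_plus s" if "t > N" for t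
    proof
      assume eq: "V t = u_plus s"
      have "P t = 0"
        by (rule DERIV_local_max[OF V_deriv, of "t - N"]) (use that eq N in \<open>auto simp: abs_if split: if_splits\<close>)
      then show False using E_at_rest eq by blast
    qed
    then have "u_plus s - V t > 0" if "t > N" for t using N[of t] that by force
    then show ?thesis by (rule eventually_mono[OF eventually_gt_at_top[of N]])
  qed
  ultimately show "\<exists>\<^sub>F t in at_top. V t > u_plus s" "\<exists>\<^sub>F t in at_top. V t < u_plus s"
    by (auto simp: frequently_def not_less)
qed

end

section \<open>Quantitative approach to the two end states\<close>

text \<open>The energy lost before the first passage through \<open>u_plus s / 2\<close> is at least \<open>energy_gap\<close>: either
  it already exceeds half the depth of the potential at \<open>u_plus s / 4\<close>, or \<open>V\<close> crosses
  \<open>[u_plus s / 4, u_plus s / 2]\<close> with a speed bounded below.\<close>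

definition energy_gap :: "real \<Rightarrow> real \<Rightarrow> real \<Rightarrow> real" where
  "energy_gap s \<epsilon> A = min (- Phi s (u_plus s / 4) / 2)
     (\<epsilon> * sqrt (- Phi s (u_plus s / 4) / A) * (u_plus s / 4))"

text \<open>Bounds \<open>A * P * z + \<epsilon> * z^2 / 2\<close> with
  \<open>z = V - u_plus s\<close>, the boundary term of the virial identity, by means of
  \<open>momentum_le\<close> and \<open>\<bar>z\<bar> <= s\<close>.\<close>

definition flux_bound :: "real \<Rightarrow> real \<Rightarrow> real \<Rightarrow> real" where
  "flux_bound s \<epsilon> A = s * sqrt (2 * A * - Phi s (u_plus s)) + \<epsilon> * s\<^sup>2 / 2"

definition back_bound :: "real \<Rightarrow> real \<Rightarrow> real \<Rightarrow> real" where
  "back_bound s \<epsilon> A = sqrt (2 * s) *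
     (2 * A / \<epsilon> * sqrt (- Phi s (u_plus s)) + 2 * (flux_bound s \<epsilon> A / sqrt (energy_gap s \<epsilon> A)))"

text \<open>The numerator bounds the boundary terms of the once integrated equation; the divisor is
  the rate from \<open>phi_le_linear\<close>.\<close>

definition front_bound :: "real \<Rightarrow> real \<Rightarrow> real \<Rightarrow> real" where
  "front_bound s \<epsilon> A =
     (2 * sqrt (2 * A * - Phi s (u_plus s)) + \<epsilon> * (u_plus s / 2)) / (u_plus s / 4)"

context wave_profile
begin

lemma first_crossing:
  obtains a where "V a = u_plus s / 2" "\<And>t. t \<le> a \<Longrightarrow> V t \<le> u_plus s / 2"
proof -
  define S where "S = {t. u_plus s / 2 \<le> V t}"
  define a where "a = Inf S"
  have half: "0 < u_plus s / 2" "u_plus s / 2 < u_plus s" using u_plus_props by auto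
  obtain b where b: "\<And>t. t \<le> b \<Longrightarrow> V t < u_plus s / 2"
    using order_tendstoD(2)[OF V_bot half(1)] by (auto simp: eventually_at_bot_linorder)
  have cl: "closed S"
    unfolding S_def by (intro closed_Collect_le V_cont continuous_on_const)
  have bdd: "bdd_below S"
  proof (rule bdd_belowI)
    fix t assume "t \<in> S"
    then show "b \<le> t" using b[of t] by (cases "t \<le> b") (auto simp: S_def)
  qed
  have ne: "S \<noteq> {}"
    using order_tendstoD(1)[OF V_top half(2)]
    by (auto simp: eventually_at_top_linorder S_def intro: less_imp_le)
  have aS: "a \<in> S" unfolding a_def by (rule closed_contains_Inf[OF ne bdd cl])
  have below: "V t < u_plus s / 2" if "t < a" for t
    using cInf_lower[OF _ bdd, of t] that by (force simp: S_def a_def)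
  obtain x where x: "a - 1 \<le> x" "x \<le> a" "V x = u_plus s / 2"
    using IVT'[of V "a - 1" "u_plus s / 2" a] below[of "a - 1"] aS V_cont by (auto simp: S_def)
  then have "x = a" using below[of x] by force
  then have "V a = u_plus s / 2" using x by simp
  moreover have "V t \<le> u_plus s / 2" if "t \<le> a" for t
    using that below[of t] calculation by (cases "t = a") auto
  ultimately show ?thesis by (rule that)
qed

lemma energy_gap_pos: "energy_gap s \<epsilon> A > 0"
proof -
  have "Phi s (u_plus s / 4) < 0"
    using Phi_decreasing[of 0 "u_plus s / 4" s] u_plus_props s by simp
  then show ?thesis unfolding energy_gap_def using \<epsilon> A u_plus_props by (auto intro!: mult_pos_pos divide_neg_pos)
qed

lemma E_first_crossing_le:
  assumes a: "V a = u_plus s / 2" "\<And>t. t \<le> a \<Longrightarrow> V t \<le> u_plus s / 2"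
  shows "E a \<le> - energy_gap s \<epsilon> A"
proof -
  define k where "k = - Phi s (u_plus s / 4)"
  have k: "k > 0"
    using Phi_decreasing[of 0 "u_plus s / 4" s] u_plus_props s by (simp add: k_def)
  show ?thesis
  proof (cases "E a \<le> - (k / 2)")
    case True
    then show ?thesis by (simp add: energy_gap_def k_def)
  next
    case False
    obtain b where b: "\<And>t. t \<le> b \<Longrightarrow> V t < u_plus s / 4"
      using order_tendstoD(2)[OF V_bot, of "u_plus s / 4"] u_plus_props
      by (auto simp: eventually_at_bot_linorder)
    have ab: "V (min a b) \<le> u_plus s / 4" "u_plus s / 4 \<le> V a"
      using b[of "min a b"] a(1) u_plus_props by auto
    obtain c where c: "c \<le> a" "V c = u_plus s / 4" "\<And>t. c \<le> t \<Longrightarrow> t \<le> a \<Longrightarrow> u_plus s / 4 \<le> V t"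
      by (rule last_crossing[OF min.cobounded1[of a b] V_cont ab]) (rule that)
    \<comment> \<open>On the crossing the speed is at least \<open>sqrt (k / A)\<close>, so
      \<open>E\<close> loses at least \<open>\<epsilon> * sqrt (k / A)\<close> per unit of
      \<open>V\<close>, however long the crossing lasts.\<close>
    have "E a + \<epsilon> * sqrt (k / A) * V a \<le> E c + \<epsilon> * sqrt (k / A) * V c"
    proof (rule DERIV_nonpos_imp_nonincreasing[OF c(1)])
      fix t assume t: "c \<le> t" "t \<le> a"
      have "Phi s (V t) \<le> Phi s (u_plus s / 4)"
        using c(3)[OF t] a(2)[OF t(2)] Phi_decreasing[of "u_plus s / 4" "V t" s] u_plus_props s
        by (cases "V t = u_plus s / 4") (auto simp del: eq_divide_eq_numeral1)
      then have "k / 2 \<le> A * (P t)\<^sup>2 / 2"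
        using E_antimono[OF t(2)] False by (simp add: E_def k_def)
      then have "k / A \<le> (P t)\<^sup>2" using A by (simp add: field_simps)
      from real_sqrt_le_mono[OF this] have root: "sqrt (k / A) \<le> \<bar>P t\<bar>" by simp
      have "sqrt (k / A) * P t \<le> sqrt (k / A) * \<bar>P t\<bar>"
        using k A by (intro mult_left_mono) auto
      also have "\<dots> \<le> \<bar>P t\<bar> * \<bar>P t\<bar>" using root by (intro mult_right_mono) auto
      finally have "\<epsilon> * (sqrt (k / A) * P t) \<le> \<epsilon> * (P t)\<^sup>2"
        using \<epsilon> by (intro mult_left_mono) (auto simp: power2_eq_square)
      moreover have "((\<lambda>t. E t + \<epsilon> * sqrt (k / A) * V t) has_real_derivative
          - \<epsilon> * (P t)\<^sup>2 + \<epsilon> * sqrt (k / A) * P t) (at t)"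
        by (auto intro!: derivative_eq_intros E_deriv V_deriv)
      ultimately show "\<exists>y. ((\<lambda>t. E t + \<epsilon> * sqrt (k / A) * V t) has_real_derivative y) (at t) \<and> y \<le> 0"
        by (intro exI conjI) (auto simp: mult.assoc)
    qed
    then have "E a \<le> - (\<epsilon> * sqrt (k / A) * (u_plus s / 4))"
      using E_nonpos[of c] c(2) a(1) by simp
    then show ?thesis by (simp add: energy_gap_def k_def)
  qed
qed

text \<open>\<open>A * P + \<epsilon> * V\<close> has derivative \<open>- phi s V\<close>, which
  dominates a multiple of \<open>V\<close> as long as \<open>V <= u_plus s / 2\<close>. The integral
  is thus controlled by the two end values, independently of \<open>T\<close>.\<close>

lemma front_integral:
  assumes a: "\<And>t. t \<le> a \<Longrightarrow> V t \<le> u_plus s / 2" and T: "T \<ge> 0"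
  shows "integral {a - T..a} V \<le> front_bound s \<epsilon> A"
proof -
  define M where "M = sqrt (2 * A * - Phi s (u_plus s))"
  define \<kappa> where "\<kappa> = u_plus s / 4"
  have kap: "\<kappa> > 0" using u_plus_props by (simp add: \<kappa>_def)
  have d: "((\<lambda>t. A * P t + \<epsilon> * V t) has_real_derivative - phi s (V t)) (at t)" for t
    using A by (auto intro!: derivative_eq_intros P_deriv V_deriv)
  have i1: "((\<lambda>t. - phi s (V t)) has_integral
      (A * P a + \<epsilon> * V a) - (A * P (a - T) + \<epsilon> * V (a - T))) {a - T..a}"
    using T d by (intro fundamental_theorem_of_calculus)
       (auto simp: has_real_derivative_iff_has_vector_derivative[symmetric] intro: DERIV_subset)
  have i2: "((\<lambda>t. \<kappa> * V t) has_integral \<kappa> * integral {a - T..a} V) {a - T..a}"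
    by (intro has_integral_mult_right integrable_integral integrable_continuous_real V_cont)
  have "\<kappa> * integral {a - T..a} V \<le> (A * P a + \<epsilon> * V a) - (A * P (a - T) + \<epsilon> * V (a - T))"
  proof (rule has_integral_le[OF i2 i1])
    fix t assume "t \<in> {a - T..a}"
    then show "\<kappa> * V t \<le> - phi s (V t)"
      using phi_le_linear[OF V_nonneg a s, of t] by (simp add: \<kappa>_def)
  qed
  also have "\<dots> \<le> 2 * M + \<epsilon> * (u_plus s / 2)"
  proof -
    have "\<epsilon> * V a \<le> \<epsilon> * (u_plus s / 2)" using \<epsilon> a[of a] by (intro mult_left_mono) auto
    moreover have "0 \<le> \<epsilon> * V (a - T)" using \<epsilon> V_nonneg by simp
    ultimately show ?thesis using momentum_le[of a] momentum_le[of "a - T"] by (simp add: M_def abs_le_iff)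
  qed
  finally show ?thesis
    using kap unfolding front_bound_def M_def[symmetric] \<kappa>_def[symmetric]
    by (subst pos_le_divide_eq) (auto simp: mult.commute)
qed

lemma back_integral:
  assumes a: "E a < 0" and gap: "E a \<le> - energy_gap s \<epsilon> A" and T: "T \<ge> 0"
  shows "integral {a..a + T} (\<lambda>t. (V t - u_plus s)\<^sup>2) \<le> back_bound s \<epsilon> A"
proof -
  \<comment> \<open>The weight \<open>w = (- E)\<^bsup>-1/2\<^esup>\<close> controls the loops that come back near the saddle \<open>0\<close>:
    \<open>- E \<le> - Phi s V \<le> s V\<^sup>2 / 2\<close> turns \<open>w phi (V - u_plus) \<ge> w V (V - u_plus)\<^sup>2 / 2\<close> into a multiple of
    \<open>(V - u_plus)\<^sup>2\<close>, while the kinetic term \<open>A w P\<^sup>2\<close> is the exact derivative of \<open>2 A / \<epsilon> sqrt (- E)\<close>.\<close>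
  define e where "e = (\<lambda>t. sqrt (- E t))"
  define w where "w = (\<lambda>t. 1 / e t)"
  define B where "B = flux_bound s \<epsilon> A"
  define z where "z = (\<lambda>t. V t - u_plus s)"
  define J where "J = (\<lambda>t. A * P t * z t + \<epsilon> * (z t)\<^sup>2 / 2)"
  \<comment> \<open>In the derivative of \<open>L\<close> the last term cancels the kinetic energy,
    and \<open>- B * w\<close> replaces \<open>J\<close> by \<open>J + B >= 0\<close>, which meets
    the favourable sign of \<open>w'\<close>.\<close>
  define L where "L = (\<lambda>t. - (w t * J t) - B * w t + 2 * A / \<epsilon> * e t)"
  define w' where "w' = (\<lambda>t. - (\<epsilon> * (P t)\<^sup>2 / (2 * e t)) / (e t)\<^sup>2)"
  have Eneg: "E t < 0" if "t \<ge> a" for t using E_antimono[OF that] a by simp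
  have epos: "e t > 0" if "t \<ge> a" for t using Eneg[OF that] by (simp add: e_def)
  have zabs: "\<bar>z t\<bar> \<le> s" for t
    using V_nonneg[of t] V_less[of t] u_plus_props by (auto simp: z_def)
  have dz: "(z has_real_derivative P t) (at t)" for t
    unfolding z_def by (auto intro!: derivative_eq_intros V_deriv)
  have de: "(e has_real_derivative \<epsilon> * (P t)\<^sup>2 / (2 * e t)) (at t)" if "t \<ge> a" for t
    using Eneg[OF that] unfolding e_def
    by (auto intro!: derivative_eq_intros E_deriv simp: field_simps)
  have dw: "(w has_real_derivative w' t) (at t)" if "t \<ge> a" for t
    using epos[OF that] unfolding w_def w'_def
    by (auto intro!: derivative_eq_intros de[OF that] simp: power2_eq_square)
  have dJ: "(J has_real_derivative A * (P t)\<^sup>2 - phi s (V t) * z t) (at t)" for t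
    unfolding J_def using A
    by (auto intro!: derivative_eq_intros P_deriv dz simp: field_simps power2_eq_square)
  have dL: "(L has_real_derivative w t * phi s (V t) * z t - w' t * (J t + B)) (at t)" if "t \<ge> a" for t
  proof -
    have "2 * A / \<epsilon> * (\<epsilon> * (P t)\<^sup>2 / (2 * e t)) = w t * (A * (P t)\<^sup>2)"
      using epos[OF that] \<epsilon> by (simp add: w_def)
    moreover have "(L has_real_derivative - (w' t * J t + (A * (P t)\<^sup>2 - phi s (V t) * z t) * w t)
        - B * w' t + 2 * A / \<epsilon> * (\<epsilon> * (P t)\<^sup>2 / (2 * e t))) (at t)"
      unfolding L_def
      by (intro DERIV_add DERIV_diff DERIV_minus DERIV_mult DERIV_cmult dw[OF that] de[OF that] dJ)
    ultimately show ?thesis by (simp add: algebra_simps)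
  qed
  have Jabs: "\<bar>J t\<bar> \<le> B" for t
  proof -
    have "\<bar>A * P t * z t\<bar> \<le> sqrt (2 * A * - Phi s (u_plus s)) * s"
      unfolding abs_mult[of "A * P t"] using zabs momentum_le
      by (intro mult_mono) (use A Phi_u_plus_neg in \<open>auto simp: mult_nonneg_nonpos\<close>)
    moreover have "(z t)\<^sup>2 \<le> s\<^sup>2" using zabs[of t] s by (intro abs_le_square_iff[THEN iffD1]) auto
    then have "\<epsilon> * (z t)\<^sup>2 \<le> \<epsilon> * s\<^sup>2" using \<epsilon> by simp
    moreover have "0 \<le> \<epsilon> * (z t)\<^sup>2" using \<epsilon> by simp
    ultimately show ?thesis
      unfolding J_def B_def flux_bound_def by (auto simp: mult.commute)
  qed
  have rate: "(z t)\<^sup>2 / sqrt (2 * s) \<le> w t * phi s (V t) * z t - w' t * (J t + B)" if t: "t \<ge> a" for t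
  proof -
    have "- E t \<le> s * (V t)\<^sup>2 / 2"
    proof -
      have "0 \<le> A * (P t)\<^sup>2 / 2" using A by simp
      then show ?thesis using Phi_ge_square[OF V_nonneg V_less, of t] by (simp add: E_def)
    qed
    then have "(e t)\<^sup>2 \<le> s * (V t)\<^sup>2 / 2" using Eneg[OF t] by (simp add: e_def)
    moreover have "(sqrt (2 * s) * V t / 2)\<^sup>2 = s * (V t)\<^sup>2 / 2"
      using s by (simp add: power_mult_distrib power_divide)
    ultimately have "e t \<le> sqrt (2 * s) * V t / 2"
      using V_nonneg[of t] s by (intro power2_le_imp_le[of "e t"]) auto
    then have "1 / sqrt (2 * s) \<le> w t * V t / 2"
      using epos[OF t] s by (simp add: w_def field_simps)
    then have "(z t)\<^sup>2 * (1 / sqrt (2 * s)) \<le> (z t)\<^sup>2 * (w t * V t / 2)"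
      by (intro mult_left_mono) auto
    also have "\<dots> = w t * (V t * (z t)\<^sup>2 / 2)" by simp
    also have "\<dots> \<le> w t * (phi s (V t) * z t)"
      using phi_times_ge[OF V_nonneg V_less, of t] epos[OF t]
      by (intro mult_left_mono) (auto simp: z_def w_def)
    finally have 1: "(z t)\<^sup>2 / sqrt (2 * s) \<le> w t * phi s (V t) * z t" by (simp add: mult.assoc)
    have "0 \<le> J t + B" using Jabs[of t] by simp
    moreover have "w' t \<le> 0" using epos[OF t] \<epsilon> by (auto simp: w'_def)
    ultimately have "w' t * (J t + B) \<le> 0" by (simp add: mult_nonpos_nonneg)
    with 1 show ?thesis by simp
  qed
  have i1: "((\<lambda>t. w t * phi s (V t) * z t - w' t * (J t + B)) has_integral L (a + T) - L a) {a..a + T}"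
    using T dL by (intro fundamental_theorem_of_calculus)
       (auto simp: has_real_derivative_iff_has_vector_derivative[symmetric] intro: DERIV_subset)
  have i2: "((\<lambda>t. (z t)\<^sup>2 / sqrt (2 * s)) has_integral
      integral {a..a + T} (\<lambda>t. (z t)\<^sup>2) / sqrt (2 * s)) {a..a + T}"
    unfolding z_def
    by (intro has_integral_divide integrable_integral integrable_continuous_real continuous_intros V_cont)
  have "integral {a..a + T} (\<lambda>t. (z t)\<^sup>2) / sqrt (2 * s) \<le> L (a + T) - L a"
    by (rule has_integral_le[OF i2 i1]) (use rate in auto)
  also have "\<dots> \<le> 2 * A / \<epsilon> * sqrt (- Phi s (u_plus s)) + 2 * (B / sqrt (energy_gap s \<epsilon> A))"
  proof -
    \<comment> \<open>At \<open>a + T\<close> the term \<open>- B * w\<close> absorbs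
      \<open>- (w * J)\<close>, so no bound on \<open>w\<close> is required there. At
      \<open>a\<close> the two add up to at most \<open>2 * B * w a\<close>, which the energy gap
      controls.\<close>
    have wJ: "- (w t * J t) \<le> B * w t" "w t * J t \<le> B * w t" if "t \<ge> a" for t
    proof -
      have "0 \<le> w t" using epos[OF that] by (simp add: w_def)
      then have "w t * - J t \<le> w t * B" "w t * J t \<le> w t * B"
        using Jabs[of t] by (auto intro!: mult_left_mono simp only: abs_le_iff)
      then show "- (w t * J t) \<le> B * w t" "w t * J t \<le> B * w t"
        by (auto simp only: mult.commute mult_minus_right)
    qed
    have "L (a + T) \<le> 2 * A / \<epsilon> * e (a + T)"
      using wJ(1)[of "a + T"] T by (simp add: L_def)
    also have "\<dots> \<le> 2 * A / \<epsilon> * sqrt (- Phi s (u_plus s))"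
      using E_greater[of "a + T"] A \<epsilon> unfolding e_def
      by (intro mult_left_mono real_sqrt_le_mono) auto
    finally have 1: "L (a + T) \<le> 2 * A / \<epsilon> * sqrt (- Phi s (u_plus s))" .
    have "0 \<le> 2 * A / \<epsilon> * e a" using A \<epsilon> epos[of a] by simp
    then have "- L a \<le> 2 * (B * w a)" using wJ(2)[of a] by (simp add: L_def)
    also have "B * w a \<le> B / sqrt (energy_gap s \<epsilon> A)"
    proof -
      have "0 \<le> B" using Jabs[of a] by (rule order_trans[OF abs_ge_zero])
      moreover have "sqrt (energy_gap s \<epsilon> A) \<le> e a"
        unfolding e_def using gap by (intro real_sqrt_le_mono) simp
      ultimately show ?thesis
        using energy_gap_pos unfolding w_def by (auto intro!: frac_le)
    qed
    finally show ?thesis using 1 by simp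
  qed
  finally have "integral {a..a + T} (\<lambda>t. (z t)\<^sup>2)
      \<le> (2 * A / \<epsilon> * sqrt (- Phi s (u_plus s)) + 2 * (B / sqrt (energy_gap s \<epsilon> A))) * sqrt (2 * s)"
    using s by (simp add: pos_divide_le_eq)
  then show ?thesis by (simp add: back_bound_def B_def z_def mult.commute)
qed

text \<open>The square is traded for the first power by \<open>2 * r * x <= r^2 + x^2\<close> with
  \<open>r = sqrt (back_bound s \<epsilon> A)\<close>; integration gives the factor
  \<open>(T + 1) / 2\<close>.\<close>

lemma L1_front:
  obtains a where "\<And>T. T \<ge> 0 \<Longrightarrow> integral {a - T..a} V \<le> front_bound s \<epsilon> A"
    "\<And>T. T \<ge> 0 \<Longrightarrow> integral {a..a + T} (\<lambda>t. \<bar>V t - u_plus s\<bar>) \<le> (T + 1) / 2 * sqrt (back_bound s \<epsilon> A)"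
proof -
  obtain a where a: "V a = u_plus s / 2" "\<And>t. t \<le> a \<Longrightarrow> V t \<le> u_plus s / 2"
    by (rule first_crossing) (rule that)
  have gap: "E a \<le> - energy_gap s \<epsilon> A" by (rule E_first_crossing_le[OF a])
  then have neg: "E a < 0" using energy_gap_pos by simp
  have Bpos: "back_bound s \<epsilon> A > 0"
  proof -
    have "0 \<le> flux_bound s \<epsilon> A"
      unfolding flux_bound_def using \<epsilon> A s Phi_u_plus_neg by (intro add_nonneg_nonneg mult_nonneg_nonneg) (auto simp: mult_nonneg_nonpos)
    then have "0 \<le> flux_bound s \<epsilon> A / sqrt (energy_gap s \<epsilon> A)" using energy_gap_pos by simp
    moreover have "0 < 2 * A / \<epsilon> * sqrt (- Phi s (u_plus s))"
      using \<epsilon> A Phi_u_plus_neg by simp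
    ultimately show ?thesis unfolding back_bound_def using s by (intro mult_pos_pos) auto
  qed
  have "integral {a..a + T} (\<lambda>t. \<bar>V t - u_plus s\<bar>) \<le> (T + 1) / 2 * sqrt (back_bound s \<epsilon> A)"
    if T: "T \<ge> 0" for T
  proof -
    define r where "r = sqrt (back_bound s \<epsilon> A)"
    have r: "r > 0" "r\<^sup>2 = back_bound s \<epsilon> A" using Bpos by (auto simp: r_def)
    let ?I = "integral {a..a + T} (\<lambda>t. (V t - u_plus s)\<^sup>2)"
    have i1: "((\<lambda>t. r / 2 + (V t - u_plus s)\<^sup>2 / (2 * r)) has_integral
        r / 2 * T + ?I / (2 * r)) {a..a + T}"
      using T has_integral_const_real[of "r / 2" a "a + T"]
      by (intro has_integral_add has_integral_divide integrable_integral integrable_continuous_real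
           continuous_intros V_cont) (auto simp: mult.commute)
    have i2: "((\<lambda>t. \<bar>V t - u_plus s\<bar>) has_integral integral {a..a + T} (\<lambda>t. \<bar>V t - u_plus s\<bar>)) {a..a + T}"
      by (intro integrable_integral integrable_continuous_real continuous_intros V_cont)
    have le: "\<bar>V t - u_plus s\<bar> \<le> r / 2 + (V t - u_plus s)\<^sup>2 / (2 * r)" for t
    proof -
      have "0 \<le> (\<bar>V t - u_plus s\<bar> - r)\<^sup>2" by simp
      then have "2 * r * \<bar>V t - u_plus s\<bar> \<le> r\<^sup>2 + (V t - u_plus s)\<^sup>2"
        by (simp add: power2_diff mult_ac)
      then show ?thesis using r(1) by (simp add: field_simps power2_eq_square)
    qed
    have "integral {a..a + T} (\<lambda>t. \<bar>V t - u_plus s\<bar>) \<le> r / 2 * T + ?I / (2 * r)"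
      by (rule has_integral_le[OF i2 i1 le])
    also have "\<dots> \<le> r / 2 * T + r\<^sup>2 / (2 * r)"
      using back_integral[OF neg gap T] r by (intro add_left_mono divide_right_mono) auto
    also have "\<dots> = (T + 1) / 2 * r" using r(1) by (simp add: field_simps power2_eq_square)
    finally show ?thesis by (simp add: r_def)
  qed
  with front_integral[OF a(2)] show ?thesis by (rule that)
qed

end

section \<open>Vanishing of the bounds and reduction to the profile equation\<close>

lemma front_bound_tendsto:
  assumes "(A \<longlongrightarrow> 0) F" "(\<epsilon> \<longlongrightarrow> 0) F"
  shows "((\<lambda>i. front_bound s (\<epsilon> i) (A i)) \<longlongrightarrow> 0) F"
proof -
  have "((\<lambda>i. (2 * sqrt (2 * A i * - Phi s (u_plus s)) + \<epsilon> i * (u_plus s / 2)) / (u_plus s / 4)) \<longlongrightarrow>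
      (2 * sqrt (2 * 0 * - Phi s (u_plus s)) + 0 * (u_plus s / 2)) * inverse (u_plus s / 4)) F"
    unfolding divide_inverse[of _ "u_plus s / 4"] by (intro tendsto_intros assms)
  then show ?thesis by (simp add: front_bound_def)
qed

text \<open>The delicate quotient is \<open>flux_bound / sqrt energy_gap\<close>, treated through
  its square \<open>f^2 / energy_gap\<close>. The reciprocal of the minimum is at most the sum of
  the reciprocals. After expansion of \<open>f^2 * sqrt A / \<epsilon>\<close>, the only term still
  divided by \<epsilon> contains \<open>A / \<epsilon>\<close>.\<close>

lemma back_bound_tendsto:
  fixes A \<epsilon> :: "'i \<Rightarrow> real"
  assumes s: "s > 1" and A: "\<And>i. A i > 0" and \<epsilon>: "\<And>i. \<epsilon> i > 0"
    and A0: "(A \<longlongrightarrow> 0) F" and \<epsilon>0: "(\<epsilon> \<longlongrightarrow> 0) F" and r0: "((\<lambda>i. A i / \<epsilon> i) \<longlongrightarrow> 0) F"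
  shows "((\<lambda>i. back_bound s (\<epsilon> i) (A i)) \<longlongrightarrow> 0) F"
proof -
  define K where "K = - Phi s (u_plus s)"
  define k where "k = - Phi s (u_plus s / 4)"
  define g where "g = sqrt k * (u_plus s / 4)"
  define c where "c = s * sqrt (2 * K)"
  define f where "f = (\<lambda>i. c * sqrt (A i) + s\<^sup>2 / 2 * \<epsilon> i)"
  have k: "k > 0"
    using Phi_decreasing[of 0 "u_plus s / 4" s] u_plus_pos[OF s] s by (simp add: k_def)
  have g: "g > 0" using k u_plus_pos[OF s] by (simp add: g_def)
  have flux: "flux_bound s (\<epsilon> i) (A i) = f i" for i
    by (simp add: flux_bound_def f_def c_def K_def real_sqrt_mult[symmetric] mult_ac)
  have gap: "energy_gap s (\<epsilon> i) (A i) = min (k / 2) (g * \<epsilon> i / sqrt (A i))" for i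
    unfolding energy_gap_def k_def[symmetric] by (simp add: g_def real_sqrt_divide mult_ac)
  have gap_pos: "energy_gap s (\<epsilon> i) (A i) > 0" for i
    unfolding gap using k g A \<epsilon> by simp
  have f_nonneg: "f i \<ge> 0" for i
    using A[of i] \<epsilon>[of i] s Phi_decreasing[of 0 "u_plus s" s] u_plus_pos[OF s]
    by (auto simp: f_def c_def K_def intro!: add_nonneg_nonneg mult_nonneg_nonneg)
  define b where "b = (\<lambda>i. (f i)\<^sup>2 * (2 / k) +
      (c\<^sup>2 * (A i / \<epsilon> i) * sqrt (A i) + c * s\<^sup>2 * A i + (s\<^sup>2 / 2)\<^sup>2 * \<epsilon> i * sqrt (A i)) * (1 / g))"
  have b: "(f i)\<^sup>2 / energy_gap s (\<epsilon> i) (A i) \<le> b i" for i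
  proof -
    have "1 / min x y \<le> 1 / x + 1 / y" if "x > 0" "y > 0" for x y :: real
      using that by (auto simp: min_def)
    from this[of "k / 2" "g * \<epsilon> i / sqrt (A i)"]
    have "1 / energy_gap s (\<epsilon> i) (A i) \<le> 2 / k + sqrt (A i) / (g * \<epsilon> i)"
      unfolding gap using k g A \<epsilon> by simp
    then have "(f i)\<^sup>2 * (1 / energy_gap s (\<epsilon> i) (A i)) \<le> (f i)\<^sup>2 * (2 / k + sqrt (A i) / (g * \<epsilon> i))"
      by (intro mult_left_mono) auto
    also have "\<dots> = b i"
    proof -
      define S where "S = sqrt (A i)"
      have S: "A i = S * S" using A[of i] by (simp add: S_def)
      have "(f i)\<^sup>2 * (S / (g * \<epsilon> i)) = (c\<^sup>2 * (S * S / \<epsilon> i) * S + c * s\<^sup>2 * (S * S)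
          + (s\<^sup>2 / 2)\<^sup>2 * \<epsilon> i * S) * (1 / g)"
        using g \<epsilon>[of i] by (simp add: f_def S_def[symmetric] field_simps power2_eq_square)
      then show ?thesis by (simp add: b_def distrib_left S[symmetric] S_def[symmetric])
    qed
    finally show ?thesis by simp
  qed
  have A0': "((\<lambda>i. sqrt (A i)) \<longlongrightarrow> 0) F" using tendsto_real_sqrt[OF A0] by simp
  have "(f \<longlongrightarrow> c * 0 + s\<^sup>2 / 2 * 0) F"
    unfolding f_def by (intro tendsto_intros A0' \<epsilon>0)
  then have f0: "(f \<longlongrightarrow> 0) F" by simp
  have "(b \<longlongrightarrow> 0\<^sup>2 * (2 / k) +
      (c\<^sup>2 * 0 * 0 + c * s\<^sup>2 * 0 + (s\<^sup>2 / 2)\<^sup>2 * 0 * 0) * (1 / g)) F"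
    unfolding b_def by (intro tendsto_intros A0 A0' \<epsilon>0 r0 f0)
  then have b0: "(b \<longlongrightarrow> 0) F" by simp
  have "((\<lambda>i. (f i)\<^sup>2 / energy_gap s (\<epsilon> i) (A i)) \<longlongrightarrow> 0) F"
    by (rule tendsto_sandwich[OF _ _ tendsto_const b0])
       (use b gap_pos in \<open>auto intro!: always_eventually divide_nonneg_pos\<close>)
  from tendsto_real_sqrt[OF this]
  have q0: "((\<lambda>i. flux_bound s (\<epsilon> i) (A i) / sqrt (energy_gap s (\<epsilon> i) (A i))) \<longlongrightarrow> 0) F"
    using f_nonneg by (simp add: real_sqrt_divide flux)
  have "((\<lambda>i. sqrt (2 * s) * (2 * (A i / \<epsilon> i) * sqrt K
      + 2 * (flux_bound s (\<epsilon> i) (A i) / sqrt (energy_gap s (\<epsilon> i) (A i))))) \<longlongrightarrow>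
      sqrt (2 * s) * (2 * 0 * sqrt K + 2 * 0)) F"
    by (intro tendsto_intros r0 q0)
  then show ?thesis by (simp add: back_bound_def[abs_def] K_def)
qed

section \<open>From the partial differential equations to the profile equation\<close>

lemma Dx_wave: "Dx (wave s f) = wave s (deriv f)"
proof (intro ext)
  fix x t
  \<comment> \<open>\<open>deriv\<close> chooses a number among the derivatives. Translation leaves
    the set of candidates unchanged, so the equality covers the default value at points without a
    derivative.\<close>
  show "Dx (wave s f) x t = wave s (deriv f) x t"
    using DERIV_shift[of f _ x "- (s * t)"] by (simp add: Dx_def wave_def deriv_def)
qed

lemma x_differentiable_wave:
  assumes "x_differentiable (wave s f)"
  shows "(f has_real_derivative deriv f x) (at x)"
proof -
  have "(\<lambda>y. wave s f y 0) field_differentiable (at x)"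
    using assms by (simp add: x_differentiable_def)
  then show ?thesis by (simp add: wave_def field_differentiable_derivI)
qed

lemma Dt_wave:
  assumes "(f has_real_derivative D) (at (x - s * t))"
  shows "Dt (wave s f) x t = - s * D"
proof -
  have "((\<lambda>r. x - s * r) has_real_derivative - s) (at t)"
    by (auto intro!: derivative_eq_intros)
  from DERIV_chain2[OF assms this] show ?thesis
    by (simp add: Dt_def wave_def DERIV_imp_deriv mult.commute)
qed

text \<open>The system provides the third derivative of the profile only through the
  \<open>t\<close>-derivative of \<open>u_xx\<close>. Along \<open>x = 0\<close> the profile
  variable is \<open>- s * t\<close>, and this is inverted by the chain rule.\<close>

lemma t_differentiable_wave:
  assumes "t_differentiable (wave s f)" "s \<noteq> 0"
  shows "(f has_real_derivative deriv f x) (at x)"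
proof -
  have "(\<lambda>r. wave s f 0 r) field_differentiable (at (- x / s))"
    using assms by (simp add: t_differentiable_def)
  then obtain D where D: "((\<lambda>r. f (- (s * r))) has_real_derivative D) (at (- x / s))"
    by (auto simp: field_differentiable_def wave_def)
  have "((\<lambda>x. - x / s) has_real_derivative - 1 / s) (at x)"
    by (intro derivative_eq_intros refl) (use assms in auto)
  from DERIV_chain2[OF D this] have "(f has_real_derivative D * (- 1 / s)) (at x)"
    using assms by simp
  with DERIV_imp_deriv[OF this] show ?thesis by simp
qed

lemma second_order_constant_zero:
  fixes U U1 U2 r :: "real \<Rightarrow> real"
  assumes U: "\<And>x. (U has_real_derivative U1 x) (at x)" and U1: "\<And>x. (U1 has_real_derivative U2 x) (at x)"
    and lim: "(U \<longlongrightarrow> 0) at_top" and r: "(r \<longlongrightarrow> 0) at_top"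
    and ode: "\<And>x. A * U2 x - \<epsilon> * U1 x + r x = C"
  shows "C = 0"
proof -
  \<comment> \<open>Only \<open>U \<rightarrow> 0\<close> is known, not \<open>U1 \<rightarrow> 0\<close>: along points with \<open>U1 (x n) \<rightarrow> 0\<close> the function
    \<open>W = A U1 - \<epsilon> U\<close> tends to \<open>0\<close>, although \<open>W' \<rightarrow> C\<close>.\<close>
  obtain x :: "nat \<Rightarrow> real" where x: "\<And>n. real n < x n" "\<And>n. x n < real n + 1" "(\<lambda>n. U1 (x n)) \<longlonglongrightarrow> 0"
    by (rule small_derivative_points[OF U lim]) (rule that)
  define W where "W = (\<lambda>x. A * U1 x - \<epsilon> * U x)"
  have dW: "(W has_real_derivative C - r x) (at x)" for x
  proof -
    have "(W has_real_derivative A * U2 x - \<epsilon> * U1 x) (at x)"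
      unfolding W_def by (auto intro!: derivative_eq_intros U U1)
    moreover have "A * U2 x - \<epsilon> * U1 x = C - r x" using ode[of x] by simp
    ultimately show ?thesis by simp
  qed
  have x_top: "filterlim x at_top sequentially"
    by (rule filterlim_at_top_mono[OF filterlim_real_sequentially])
       (intro always_eventually allI less_imp_le x(1))
  have "(\<lambda>n. W (x n)) \<longlonglongrightarrow> A * 0 - \<epsilon> * 0"
    unfolding W_def by (intro tendsto_intros x(3) filterlim_compose[OF lim x_top])
  then have W0: "(\<lambda>n. W (x n)) \<longlonglongrightarrow> 0" by simp
  \<comment> \<open>Consecutive points may be arbitrarily close; skipping one keeps the distance at
    least \<open>1\<close>, so increments of \<open>W\<close> control its slope.\<close>
  have step: "x n + 1 \<le> x (n + 2)" for n using x(1)[of "n + 2"] x(2)[of n] by simp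
  have "\<exists>z. x n < z \<and> W (x (n + 2)) - W (x n) = (x (n + 2) - x n) * (C - r z)" for n
    using MVT2[of "x n" "x (n + 2)" W "\<lambda>z. C - r z"] step[of n] dW by force
  then obtain z where z: "\<And>n. x n < z n"
      "\<And>n. W (x (n + 2)) - W (x n) = (x (n + 2) - x n) * (C - r (z n))"
    by metis
  have z_top: "filterlim z at_top sequentially"
    by (rule filterlim_at_top_mono[OF x_top]) (intro always_eventually allI less_imp_le z(1))
  have "(\<lambda>n. \<bar>C - r (z n)\<bar>) \<longlonglongrightarrow> \<bar>C - 0\<bar>"
    by (intro tendsto_intros filterlim_compose[OF r z_top])
  moreover have "(\<lambda>n. \<bar>C - r (z n)\<bar>) \<longlonglongrightarrow> 0"
  proof (rule tendsto_sandwich[OF _ _ tendsto_const])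
    show "(\<lambda>n. \<bar>W (x (n + 2)) - W (x n)\<bar>) \<longlonglongrightarrow> 0"
      using tendsto_rabs[OF tendsto_diff[OF LIMSEQ_ignore_initial_segment[OF W0, of 2] W0]] by simp
    have "1 * \<bar>C - r (z n)\<bar> \<le> (x (n + 2) - x n) * \<bar>C - r (z n)\<bar>" for n
      using step[of n] by (intro mult_right_mono) auto
    moreover have "\<bar>x (n + 2) - x n\<bar> = x (n + 2) - x n" for n using step[of n] by simp
    ultimately have "\<bar>C - r (z n)\<bar> \<le> \<bar>W (x (n + 2)) - W (x n)\<bar>" for n
      unfolding z(2) abs_mult by simp
    then show "\<forall>\<^sub>F n in sequentially. \<bar>C - r (z n)\<bar> \<le> \<bar>W (x (n + 2)) - W (x n)\<bar>"
      by (rule always_eventually[OF allI])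
  qed auto
  ultimately have "\<bar>C - 0\<bar> = 0" by (rule LIMSEQ_unique)
  then show ?thesis by simp
qed

text \<open>For functions of \<open>x - s * t\<close> both equations are exact derivatives, and the
  zero state ahead fixes the constants of integration. The first integral gives the elevation, and
  substituting it into the second gives the oscillator.\<close>

lemma traveling_wave_profile:
  assumes tw: "traveling_wave \<epsilon> \<delta> s H U" and s: "s > 1" and \<epsilon>: "\<epsilon> > 0" and \<delta>: "\<delta> > 0"
  shows "wave_profile s \<epsilon> (\<delta> * s) (\<lambda>t. U (- t)) (\<lambda>t. - deriv U (- t))"
    and "\<And>x. U x < s" and "\<And>x. H x = U x / (s - U x)"
proof -
  define U1 where "U1 = deriv U"
  define U2 where "U2 = deriv U1"
  define U3 where "U3 = deriv U2"
  define H1 where "H1 = deriv H"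
  have pb: "peregrine_boussinesq \<epsilon> \<delta> (wave s H) (wave s U)"
    and lim: "(H \<longlongrightarrow> 0) at_top" "(U \<longlongrightarrow> 0) at_top" "(U \<longlongrightarrow> u_plus s) at_bot"
    using tw by (auto simp: traveling_wave_def)
  have dH: "(H has_real_derivative H1 x) (at x)" for x
    unfolding H1_def by (rule x_differentiable_wave) (use pb in \<open>auto simp: peregrine_boussinesq_def\<close>)
  have dU: "(U has_real_derivative U1 x) (at x)" for x
    unfolding U1_def by (rule x_differentiable_wave) (use pb in \<open>auto simp: peregrine_boussinesq_def\<close>)
  have dU1: "(U1 has_real_derivative U2 x) (at x)" for x
    unfolding U2_def
    by (rule x_differentiable_wave[of s]) (use pb in \<open>auto simp: peregrine_boussinesq_def Dx_wave U1_def\<close>)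
  have dU2: "(U2 has_real_derivative U3 x) (at x)" for x
    unfolding U3_def
    by (rule t_differentiable_wave[of s]) (use pb s in \<open>auto simp: peregrine_boussinesq_def Dx_wave U1_def U2_def\<close>)
  have eq1: "- s * H1 x + U1 x + (H1 x * U x + H x * U1 x) = 0" for x
  proof -
    have "((\<lambda>y. H y * U y) has_real_derivative H1 x * U x + H x * U1 x) (at x)"
      by (auto intro!: derivative_eq_intros dH dU)
    then have "Dx (\<lambda>x t. wave s H x t * wave s U x t) x 0 = H1 x * U x + H x * U1 x"
      by (simp add: Dx_def wave_def DERIV_imp_deriv)
    moreover have "Dt (wave s H) x 0 = - s * H1 x" by (rule Dt_wave) (simp add: dH)
    moreover have "Dt (wave s H) x 0 + Dx (wave s U) x 0 + Dx (\<lambda>x t. wave s H x t * wave s U x t) x 0 = 0"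
      using pb by (simp add: peregrine_boussinesq_def)
    ultimately show ?thesis by (simp add: Dx_wave wave_def U1_def)
  qed
  have eq2: "- s * U1 x + H1 x + U x * U1 x + \<delta> * s * U3 x - \<epsilon> * U2 x = 0" for x
  proof -
    have "Dt (wave s U) x 0 = - s * U1 x" by (rule Dt_wave) (simp add: dU)
    moreover have "Dt (wave s U2) x 0 = - s * U3 x" by (rule Dt_wave) (simp add: dU2)
    moreover have "Dt (wave s U) x 0 + Dx (wave s H) x 0 + wave s U x 0 * Dx (wave s U) x 0
        - \<delta> * Dt (Dx (Dx (wave s U))) x 0 - \<epsilon> * Dx (Dx (wave s U)) x 0 = 0"
      using pb by (simp add: peregrine_boussinesq_def)
    ultimately show ?thesis
      by (simp add: Dx_wave U1_def[symmetric] U2_def[symmetric] H1_def[symmetric])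
         (simp add: wave_def algebra_simps)
  qed
  have HU: "- s * H x + U x + H x * U x = 0" for x
  proof -
    define G where "G = (\<lambda>x. - s * H x + U x + H x * U x)"
    have "(G has_real_derivative 0) (at y)" for y
    proof -
      have "(G has_real_derivative - s * H1 y + U1 y + (H1 y * U y + H y * U1 y)) (at y)"
        unfolding G_def by (auto intro!: derivative_eq_intros dH dU)
      then show ?thesis by (simp only: eq1)
    qed
    then have const: "G = (\<lambda>_. G x)" using DERIV_isconst_all[of G] by blast
    have "(G \<longlongrightarrow> - s * 0 + 0 + 0 * 0) at_top"
      unfolding G_def by (intro tendsto_intros lim)
    then have "G x = 0"
      by (subst (asm) const) (simp add: tendsto_const_iff)
    then show ?thesis by (simp add: G_def)
  qed
  \<comment> \<open>At \<open>U x = s\<close> the first integral would read \<open>s = 0\<close>.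
    Hence by continuity \<open>U\<close> cannot cross \<open>s\<close> on its way to
    \<open>0\<close>.\<close>
  have U_ne: "U x \<noteq> s" for x
    using HU[of x] s by (auto simp: algebra_simps)
  show U_less: "U x < s" for x
  proof (rule ccontr)
    assume "\<not> U x < s"
    moreover have "\<forall>\<^sub>F y in at_top. U y < s \<and> x \<le> y"
      using order_tendstoD(2)[OF lim(2), of s] s eventually_ge_at_top[of x]
      by (auto intro: eventually_conj)
    then obtain y where "U y < s" "x \<le> y" by (auto simp: eventually_at_top_linorder)
    moreover have "continuous_on {x..y} U"
      by (rule DERIV_continuous_on[where D = U1]) (auto intro: DERIV_subset[OF dU])
    ultimately obtain z where "U z = s" using IVT2'[of U y s x] by auto
    then show False using U_ne by blast
  qed
  show H_eq: "H x = U x / (s - U x)" for x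
    using HU[of x] U_less[of x] by (simp add: field_simps)

  have second: "\<delta> * s * U2 x - \<epsilon> * U1 x + (- s * U x + H x + (U x)\<^sup>2 / 2) = 0" for x
  proof -
    define G where "G = (\<lambda>x. \<delta> * s * U2 x - \<epsilon> * U1 x + (- s * U x + H x + (U x)\<^sup>2 / 2))"
    have "(G has_real_derivative 0) (at y)" for y
    proof -
      have "(G has_real_derivative \<delta> * s * U3 y - \<epsilon> * U2 y + (- s * U1 y + H1 y + U1 y * U y)) (at y)"
        unfolding G_def by (auto intro!: derivative_eq_intros dH dU dU1 dU2)
      moreover have "\<delta> * s * U3 y - \<epsilon> * U2 y + (- s * U1 y + H1 y + U1 y * U y) = 0"
        using eq2[of y] by (simp add: algebra_simps)
      ultimately show ?thesis by simp
    qed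
    then have const: "G y = G x" for y using DERIV_isconst_all[of G] by blast
    have "((\<lambda>x. - s * U x + H x + (U x)\<^sup>2 / 2) \<longlongrightarrow> - s * 0 + 0 + 0\<^sup>2 / 2) at_top"
      by (intro tendsto_intros lim) auto
    then have r: "((\<lambda>x. - s * U x + H x + (U x)\<^sup>2 / 2) \<longlongrightarrow> 0) at_top" by simp
    have "G x = 0"
      by (rule second_order_constant_zero[OF dU dU1 lim(2) r]) (use const in \<open>simp add: G_def\<close>)
    then show ?thesis by (simp add: G_def)
  qed
  show "wave_profile s \<epsilon> (\<delta> * s) (\<lambda>t. U (- t)) (\<lambda>t. - deriv U (- t))"
  proof
    show "((\<lambda>t. U (- t)) has_real_derivative - deriv U (- t)) (at t)" for t
      using DERIV_mirror[of U "U1 (- t)" t] dU by (simp add: U1_def)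
    have "((\<lambda>t. - U1 (- t)) has_real_derivative U2 (- t)) (at t)" for t
      using DERIV_minus[OF DERIV_mirror[of U1 "U2 (- t)" t, THEN iffD1, OF dU1]] by simp
    moreover have "U2 (- t) = - (\<epsilon> * - U1 (- t) + phi s (U (- t))) / (\<delta> * s)" for t
      using second[of "- t"] \<delta> s by (simp add: phi_def H_eq field_simps)
    ultimately show "((\<lambda>t. - deriv U (- t)) has_real_derivative
        - (\<epsilon> * - deriv U (- t) + phi s (U (- t))) / (\<delta> * s)) (at t)" for t
      by (simp add: U1_def)
    show "((\<lambda>t. U (- t)) \<longlongrightarrow> 0) at_bot"
      using lim(2) by (simp add: at_bot_mirror filterlim_filtermap)
    show "((\<lambda>t. U (- t)) \<longlongrightarrow> u_plus s) at_top"
      using lim(3) by (simp add: at_bot_mirror filterlim_filtermap)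
  qed (use s \<epsilon> \<delta> U_less in auto)
qed

section \<open>Convergence to the shock\<close>

text \<open>For fixed \<open>t\<close> the shift by \<open>s * t\<close> preserves Lebesgue measure.
  Points of the box have \<open>x - s * t\<close> within \<open>(1 + s) * R\<close> of zero, and the
  time interval contributes \<open>2 * R\<close>.\<close>

lemma nn_integral_wave_le:
  fixes f :: "real \<Rightarrow> real"
  assumes [measurable]: "f \<in> borel_measurable borel" and K: "K \<subseteq> {- R..R} \<times> {- R..R}"
    and s: "s \<ge> 0" and R: "R \<ge> 0"
  shows "(\<integral>\<^sup>+ p \<in> K. ennreal \<bar>f (fst p - s * snd p)\<bar> \<partial>lborel)
    \<le> ennreal (2 * R) * (\<integral>\<^sup>+ \<xi> \<in> {- ((1 + s) * R)..(1 + s) * R}. ennreal \<bar>f \<xi>\<bar> \<partial>lborel)"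
proof -
  define g where "g = (\<lambda>\<xi>. ennreal \<bar>f \<xi>\<bar> * indicator {- ((1 + s) * R)..(1 + s) * R} \<xi>)"
  have [measurable]: "g \<in> borel_measurable borel" unfolding g_def by measurable
  have "(\<integral>\<^sup>+ p \<in> K. ennreal \<bar>f (fst p - s * snd p)\<bar> \<partial>lborel)
      \<le> (\<integral>\<^sup>+ p. g (fst p - s * snd p) * indicator {- R..R} (snd p) \<partial>lborel)"
  proof (rule nn_integral_mono)
    fix p :: "real \<times> real"
    show "ennreal \<bar>f (fst p - s * snd p)\<bar> * indicator K p
        \<le> g (fst p - s * snd p) * indicator {- R..R} (snd p)"
    proof (cases "p \<in> K")
      case True
      then have p: "\<bar>fst p\<bar> \<le> R" "\<bar>snd p\<bar> \<le> R" using K by (auto simp: abs_le_iff)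
      have "\<bar>s * snd p\<bar> \<le> s * R" using p s by (simp add: abs_mult mult_left_mono)
      then have "fst p - s * snd p \<in> {- ((1 + s) * R)..(1 + s) * R}"
        using p by (auto simp: distrib_right abs_le_iff)
      moreover have "snd p \<in> {- R..R}" using p by (auto simp: abs_le_iff)
      ultimately show ?thesis using True by (simp add: g_def)
    qed simp
  qed
  also have "\<dots> = (\<integral>\<^sup>+ t. (\<integral>\<^sup>+ x. g (x - s * t) * indicator {- R..R} t \<partial>lborel) \<partial>lborel)"
    unfolding lborel_prod[symmetric]
    by (subst lborel_pair.nn_integral_snd[symmetric]) (simp_all add: measurable_split_conv)
  also have "\<dots> = (\<integral>\<^sup>+ t. (\<integral>\<^sup>+ x. g x \<partial>lborel) * indicator {- R..R} t \<partial>lborel)"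
  proof (rule nn_integral_cong)
    fix t :: real
    have "(\<integral>\<^sup>+ x. g x \<partial>lborel) = (\<integral>\<^sup>+ x. g (x - s * t) \<partial>lborel)"
      by (subst nn_integral_real_affine[of g 1 "- (s * t)"]) auto
    then show "(\<integral>\<^sup>+ x. g (x - s * t) * indicator {- R..R} t \<partial>lborel)
        = (\<integral>\<^sup>+ x. g x \<partial>lborel) * indicator {- R..R} t"
      by (simp add: nn_integral_multc)
  qed
  also have "\<dots> = (\<integral>\<^sup>+ x. g x \<partial>lborel) * ennreal (2 * R)"
    using R by (simp add: nn_integral_cmult_indicator)
  finally show ?thesis by (simp add: g_def mult.commute)
qed

lemma tends_L1_loc_jump:
  assumes cont: "\<And>i. continuous_on UNIV (f i)" and s: "s > 0"
    and le: "\<And>i T. T \<ge> 0 \<Longrightarrow>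
      (\<integral>\<^sup>+ \<xi> \<in> {- T..T}. ennreal \<bar>f i \<xi> - (if \<xi> < 0 then l else 0)\<bar> \<partial>lborel) \<le> ennreal (c T i)"
    and lim: "\<And>T. (c T \<longlongrightarrow> 0) F"
  shows "tends_L1_loc (\<lambda>i x t. f i (x - s * t)) (jump s l 0) F"
  unfolding tends_L1_loc_def
proof (intro allI impI)
  fix K :: "(real \<times> real) set" assume "compact K"
  then obtain R where R: "R > 0" "\<And>p. p \<in> K \<Longrightarrow> norm p \<le> R"
    using compact_imp_bounded by (metis bounded_pos)
  have K: "K \<subseteq> {- R..R} \<times> {- R..R}"
  proof
    fix p assume "p \<in> K"
    then have "norm p \<le> R" by (rule R(2))
    then show "p \<in> {- R..R} \<times> {- R..R}"
      using norm_fst_le[of "fst p" "snd p"] norm_snd_le[of "snd p" "fst p"]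
      by (cases p) (auto simp: abs_le_iff)
  qed
  let ?g = "\<lambda>i \<xi>. f i \<xi> - (if \<xi> < 0 then l else 0)"
  let ?T = "(1 + s) * R"
  have T: "?T \<ge> 0" using s R by simp
  have le': "(\<integral>\<^sup>+ p \<in> K. ennreal \<bar>f i (fst p - s * snd p) - jump s l 0 (fst p) (snd p)\<bar> \<partial>lborel)
      \<le> ennreal (2 * R) * ennreal (c ?T i)" for i
  proof -
    have [measurable]: "f i \<in> borel_measurable borel"
      using cont by (rule borel_measurable_continuous_onI)
    have "(\<integral>\<^sup>+ p \<in> K. ennreal \<bar>f i (fst p - s * snd p) - jump s l 0 (fst p) (snd p)\<bar> \<partial>lborel)
        = (\<integral>\<^sup>+ p \<in> K. ennreal \<bar>?g i (fst p - s * snd p)\<bar> \<partial>lborel)"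
      by (simp add: jump_def)
    also have "\<dots> \<le> ennreal (2 * R) * (\<integral>\<^sup>+ \<xi> \<in> {- ?T..?T}. ennreal \<bar>?g i \<xi>\<bar> \<partial>lborel)"
      using K s R by (intro nn_integral_wave_le) auto
    also have "\<dots> \<le> ennreal (2 * R) * ennreal (c ?T i)"
      by (intro mult_left_mono le T) auto
    finally show ?thesis .
  qed
  have "((\<lambda>i. ennreal (2 * R) * ennreal (c ?T i)) \<longlongrightarrow> ennreal (2 * R) * ennreal 0) F"
    by (intro ennreal_tendsto_cmult tendsto_ennrealI lim) auto
  then have bound: "((\<lambda>i. ennreal (2 * R) * ennreal (c ?T i)) \<longlongrightarrow> 0) F" by simp
  show "((\<lambda>i. \<integral>\<^sup>+ p \<in> K. ennreal \<bar>f i (fst p - s * snd p) - jump s l 0 (fst p) (snd p)\<bar> \<partial>lborel)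
      \<longlongrightarrow> 0) F"
    by (rule tendsto_sandwich[OF _ _ tendsto_const bound]) (auto intro!: always_eventually le')
qed

section \<open>Transfer from velocity to elevation\<close>

lemma elevation_diff:
  fixes s u v :: real
  assumes "u < s" "v < s"
  shows "u / (s - u) - v / (s - v) = s * (u - v) / ((s - u) * (s - v))"
proof -
  have "s - u \<noteq> 0" "s - v \<noteq> 0" using assms by auto
  then show ?thesis by (simp add: diff_frac_eq algebra_simps)
qed

lemma elevation_less_iff:
  fixes s u v :: real
  assumes "u < s" "v < s" "s > 0"
  shows "u / (s - u) < v / (s - v) \<longleftrightarrow> u < v"
proof -
  define c where "c = s / ((s - u) * (s - v))"
  have c: "c > 0" using assms by (simp add: c_def)
  have "u / (s - u) - v / (s - v) = c * (u - v)"
    unfolding elevation_diff[OF assms(1,2)] by (simp add: c_def)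
  then have "u / (s - u) < v / (s - v) \<longleftrightarrow> c * (u - v) < 0" by linarith
  also have "\<dots> \<longleftrightarrow> u < v" using c by (simp add: mult_less_0_iff)
  finally show ?thesis .
qed

lemma elevation_lipschitz:
  fixes s u v d e :: real
  assumes "d > 0" "d \<le> s - u" "v < s" "e \<le> s - v" "e > 0" "s > 0"
  shows "\<bar>u / (s - u) - v / (s - v)\<bar> \<le> s / (d * e) * \<bar>u - v\<bar>"
proof -
  have "u < s" using assms by linarith
  from elevation_diff[OF this assms(3)] have "\<bar>u / (s - u) - v / (s - v)\<bar> = s * \<bar>u - v\<bar> / ((s - u) * (s - v))"
    using assms by (simp add: abs_mult)
  also have "\<dots> \<le> s * \<bar>u - v\<bar> / (d * e)"
    using assms by (intro divide_left_mono mult_mono mult_pos_pos) auto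
  finally show ?thesis by simp
qed

text \<open>The two factors of the denominator are the distances to \<open>s\<close> of the profile,
  from \<open>V_away\<close>, and of the rear state. The constant is therefore the same for all
  members of the family.\<close>

definition elevation_lipschitz_const :: "real \<Rightarrow> real" where
  "elevation_lipschitz_const s = s / (s * exp (- (s\<^sup>2 / 2 + 1)) * (s - u_plus s))"

definition L1_bound :: "real \<Rightarrow> real \<Rightarrow> real \<Rightarrow> real \<Rightarrow> real" where
  "L1_bound s \<epsilon> A T = front_bound s \<epsilon> A + (T + 1) / 2 * sqrt (back_bound s \<epsilon> A)"

context wave_profile
begin

lemma L1_shock:
  obtains a where "\<And>T. T \<ge> 0 \<Longrightarrow>
      (\<integral>\<^sup>+ \<xi> \<in> {- T..T}. ennreal \<bar>V (a - \<xi>) - (if \<xi> < 0 then u_plus s else 0)\<bar> \<partial>lborel)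
        \<le> ennreal (L1_bound s \<epsilon> A T)"
proof -
  obtain a where a: "\<And>T. T \<ge> 0 \<Longrightarrow> integral {a - T..a} V \<le> front_bound s \<epsilon> A"
    "\<And>T. T \<ge> 0 \<Longrightarrow> integral {a..a + T} (\<lambda>t. \<bar>V t - u_plus s\<bar>) \<le> (T + 1) / 2 * sqrt (back_bound s \<epsilon> A)"
    by (rule L1_front) (rule that)
  have [measurable]: "V \<in> borel_measurable borel"
    using V_cont by (rule borel_measurable_continuous_onI)
  show ?thesis
  proof (rule that)
    fix T :: real assume T: "T \<ge> 0"
    \<comment> \<open>Reflection about \<open>a\<close> sends the region ahead of the shock to
      \<open>t < a\<close>. Both closed intervals contain \<open>a\<close>, which is harmless since
      \<open>g\<close> serves as an upper bound.\<close>
    define g where "g = (\<lambda>t. ennreal (V t) * indicator {a - T..a} t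
      + ennreal \<bar>V t - u_plus s\<bar> * indicator {a..a + T} t)"
    have [measurable]: "g \<in> borel_measurable borel" unfolding g_def by measurable
    have "(\<integral>\<^sup>+ \<xi> \<in> {- T..T}. ennreal \<bar>V (a - \<xi>) - (if \<xi> < 0 then u_plus s else 0)\<bar> \<partial>lborel)
        \<le> (\<integral>\<^sup>+ \<xi>. g (a + (- 1) * \<xi>) \<partial>lborel)"
      by (rule nn_integral_mono) (use V_nonneg in \<open>auto simp: g_def indicator_def\<close>)
    also have "\<dots> = (\<integral>\<^sup>+ t. g t \<partial>lborel)"
      by (subst nn_integral_real_affine[of g "- 1" a]) auto
    also have "\<dots> = (\<integral>\<^sup>+ t. ennreal (V t) * indicator {a - T..a} t \<partial>lborel)
        + (\<integral>\<^sup>+ t. ennreal \<bar>V t - u_plus s\<bar> * indicator {a..a + T} t \<partial>lborel)"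
      unfolding g_def by (rule nn_integral_add) measurable
    also have "(\<integral>\<^sup>+ t. ennreal (V t) * indicator {a - T..a} t \<partial>lborel) = ennreal (integral {a - T..a} V)"
      by (intro nn_integral_has_integral_lebesgue' integrable_integral integrable_continuous_real V_cont V_nonneg)
    also have "(\<integral>\<^sup>+ t. ennreal \<bar>V t - u_plus s\<bar> * indicator {a..a + T} t \<partial>lborel)
        = ennreal (integral {a..a + T} (\<lambda>t. \<bar>V t - u_plus s\<bar>))"
      by (intro nn_integral_has_integral_lebesgue' integrable_integral integrable_continuous_real
            continuous_intros V_cont) auto
    also have "ennreal (integral {a - T..a} V) + ennreal (integral {a..a + T} (\<lambda>t. \<bar>V t - u_plus s\<bar>))
        = ennreal (integral {a - T..a} V + integral {a..a + T} (\<lambda>t. \<bar>V t - u_plus s\<bar>))"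
      using V_nonneg by (intro ennreal_plus[symmetric] Henstock_Kurzweil_Integration.integral_nonneg
            integrable_continuous_real continuous_intros V_cont) auto
    also have "\<dots> \<le> ennreal (L1_bound s \<epsilon> A T)"
      unfolding L1_bound_def by (intro ennreal_leI add_mono a T)
    finally show "(\<integral>\<^sup>+ \<xi> \<in> {- T..T}. ennreal \<bar>V (a - \<xi>) - (if \<xi> < 0 then u_plus s else 0)\<bar> \<partial>lborel)
        \<le> ennreal (L1_bound s \<epsilon> A T)" .
  qed
qed

lemma elevation_diff_le:
  "\<bar>V t / (s - V t) - (if \<xi> < 0 then h_plus s else 0)\<bar>
    \<le> elevation_lipschitz_const s * \<bar>V t - (if \<xi> < 0 then u_plus s else 0)\<bar>"
proof -
  have "\<bar>V t / (s - V t) - v / (s - v)\<bar> \<le> elevation_lipschitz_const s * \<bar>V t - v\<bar>"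
    if "0 \<le> v" "v \<le> u_plus s" for v
    unfolding elevation_lipschitz_const_def
    using s u_plus_props that by (intro elevation_lipschitz V_away) auto
  from this[of "if \<xi> < 0 then u_plus s else 0"] show ?thesis
    using u_plus_props by (auto simp: h_plus_def)
qed

lemma L1_shock_elevation:
  assumes "(\<integral>\<^sup>+ \<xi> \<in> {- T..T}. ennreal \<bar>V (a - \<xi>) - (if \<xi> < 0 then u_plus s else 0)\<bar> \<partial>lborel) \<le> ennreal b"
  shows "(\<integral>\<^sup>+ \<xi> \<in> {- T..T}. ennreal \<bar>V (a - \<xi>) / (s - V (a - \<xi>)) - (if \<xi> < 0 then h_plus s else 0)\<bar> \<partial>lborel)
    \<le> ennreal (elevation_lipschitz_const s * b)"
proof -
  let ?C = "elevation_lipschitz_const s"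
  have C: "?C \<ge> 0" using s u_plus_props by (simp add: elevation_lipschitz_const_def)
  have [measurable]: "V \<in> borel_measurable borel"
    using V_cont by (rule borel_measurable_continuous_onI)
  have "(\<integral>\<^sup>+ \<xi> \<in> {- T..T}. ennreal \<bar>V (a - \<xi>) / (s - V (a - \<xi>)) - (if \<xi> < 0 then h_plus s else 0)\<bar> \<partial>lborel)
      \<le> (\<integral>\<^sup>+ \<xi>. ennreal ?C * (ennreal \<bar>V (a - \<xi>) - (if \<xi> < 0 then u_plus s else 0)\<bar> * indicator {- T..T} \<xi>) \<partial>lborel)"
    unfolding mult.assoc[symmetric]
    by (intro nn_integral_mono mult_right_mono)
       (simp_all add: ennreal_mult[symmetric] C elevation_diff_le ennreal_leI)
  also have "\<dots> = ennreal ?C * (\<integral>\<^sup>+ \<xi> \<in> {- T..T}. ennreal \<bar>V (a - \<xi>) - (if \<xi> < 0 then u_plus s else 0)\<bar> \<partial>lborel)"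
    by (rule nn_integral_cmult) measurable
  also have "\<dots> \<le> ennreal ?C * ennreal b" by (intro mult_left_mono assms) auto
  also have "\<dots> = ennreal (?C * b)" using C by (simp add: ennreal_mult')
  finally show ?thesis .
qed

end

text \<open>Any translate of a traveling wave is again one, so the family converges only after
  recentring. The shift \<open>a i\<close> used in the proof puts the passage through
  \<open>u_plus s / 2\<close> on the line \<open>x = s * t\<close>.\<close>

theorem mainTheorem4:
  fixes s :: real
    and F :: "'i filter"
    and \<epsilon> \<delta> :: "'i \<Rightarrow> real"
    and H U :: "'i \<Rightarrow> real \<Rightarrow> real"
  assumes "s > 1"
    and "\<And>i. \<epsilon> i > 0" and "\<And>i. \<delta> i > 0"
    and "(\<epsilon> \<longlongrightarrow> 0) F" and "(\<delta> \<longlongrightarrow> 0) F"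
    and "\<delta> \<in> o[F](\<epsilon>)"
    and "\<And>i. traveling_wave (\<epsilon> i) (\<delta> i) s (H i) (U i)"
  shows "u_plus s < s \<and>
    entropic_shock_wave s (h_plus s, u_plus s) (0, 0) \<and>
    (\<exists>a :: 'i \<Rightarrow> real.
       tends_L1_loc (\<lambda>i x t. wave s (H i) (x + a i) t) (jump s (h_plus s) 0) F \<and>
       tends_L1_loc (\<lambda>i x t. wave s (U i) (x + a i) t) (jump s (u_plus s) 0) F) \<and>
    (\<forall>i. (\<epsilon> i)\<^sup>2 < 4 * \<delta> i * s * alpha s \<longrightarrow> undular_bore s (H i) (U i))"
proof -
  have profile: "wave_profile s (\<epsilon> i) (\<delta> i * s) (\<lambda>t. U i (- t)) (\<lambda>t. - deriv (U i) (- t))"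
    and U_less: "U i x < s" and H_eq: "H i x = U i x / (s - U i x)" for i x
    using traveling_wave_profile[OF assms(7,1,2,3)] by auto
  have U_cont: "continuous_on UNIV (U i)" for i
  proof -
    have "continuous_on UNIV (\<lambda>x. (\<lambda>t. U i (- t)) (- x))"
      by (rule continuous_on_compose2[OF wave_profile.V_cont[OF profile, of UNIV]]) (auto intro!: continuous_intros)
    then show ?thesis by simp
  qed
  have "\<exists>a. \<forall>T\<ge>0. (\<integral>\<^sup>+ \<xi> \<in> {- T..T}. ennreal \<bar>U i (- (a - \<xi>)) - (if \<xi> < 0 then u_plus s else 0)\<bar> \<partial>lborel)
      \<le> ennreal (L1_bound s (\<epsilon> i) (\<delta> i * s) T)" for i
    by (rule wave_profile.L1_shock[OF profile[of i]]) blast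
  then have "\<forall>i. \<exists>a. \<forall>T\<ge>0.
      (\<integral>\<^sup>+ \<xi> \<in> {- T..T}. ennreal \<bar>U i (- (a - \<xi>)) - (if \<xi> < 0 then u_plus s else 0)\<bar> \<partial>lborel)
      \<le> ennreal (L1_bound s (\<epsilon> i) (\<delta> i * s) T)" by (rule allI)
  from choice[OF this] obtain b where b: "\<And>i T. T \<ge> 0 \<Longrightarrow>
      (\<integral>\<^sup>+ \<xi> \<in> {- T..T}. ennreal \<bar>U i (- (b i - \<xi>)) - (if \<xi> < 0 then u_plus s else 0)\<bar> \<partial>lborel)
      \<le> ennreal (L1_bound s (\<epsilon> i) (\<delta> i * s) T)"
    by blast
  have A0: "((\<lambda>i. \<delta> i * s) \<longlongrightarrow> 0) F"
    using tendsto_mult_right[OF assms(5), of s] by simp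
  have r0: "((\<lambda>i. \<delta> i * s / \<epsilon> i) \<longlongrightarrow> 0) F"
    using tendsto_mult_right[OF smalloD_tendsto[OF assms(6)], of s] by simp
  have back_lim: "((\<lambda>i. back_bound s (\<epsilon> i) (\<delta> i * s)) \<longlongrightarrow> 0) F"
    using assms by (intro back_bound_tendsto A0 r0) auto
  have "((\<lambda>i. L1_bound s (\<epsilon> i) (\<delta> i * s) T) \<longlongrightarrow> 0 + (T + 1) / 2 * sqrt 0) F" for T
    unfolding L1_bound_def by (intro tendsto_intros front_bound_tendsto back_lim A0 assms(4))
  then have lim: "((\<lambda>i. L1_bound s (\<epsilon> i) (\<delta> i * s) T) \<longlongrightarrow> 0) F" for T by simp
  have limC: "((\<lambda>i. elevation_lipschitz_const s * L1_bound s (\<epsilon> i) (\<delta> i * s) T) \<longlongrightarrow> 0) F" for T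
    using tendsto_mult_left[OF lim[of T], of "elevation_lipschitz_const s"] by simp
  have "tends_L1_loc (\<lambda>i x t. U i (- (b i - (x - s * t)))) (jump s (u_plus s) 0) F"
  proof (rule tends_L1_loc_jump)
    show "continuous_on UNIV (\<lambda>\<xi>. U i (- (b i - \<xi>)))" for i
      by (rule continuous_on_compose2[OF U_cont]) (auto intro!: continuous_intros)
  qed (use assms(1) b lim in auto)
  then have tU: "tends_L1_loc (\<lambda>i x t. wave s (U i) (x + - b i) t) (jump s (u_plus s) 0) F"
    by (simp add: wave_def algebra_simps)
  have "tends_L1_loc (\<lambda>i x t. H i (- (b i - (x - s * t)))) (jump s (h_plus s) 0) F"
  proof (rule tends_L1_loc_jump)
    have H_cont: "continuous_on UNIV (H i)" for i
      unfolding H_eq[abs_def] using U_less[of i] by (intro continuous_intros U_cont) (auto simp: less_imp_neq)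
    show "continuous_on UNIV (\<lambda>\<xi>. H i (- (b i - \<xi>)))" for i
      by (rule continuous_on_compose2[OF H_cont]) (auto intro!: continuous_intros)
    show "(\<integral>\<^sup>+ \<xi> \<in> {- T..T}. ennreal \<bar>H i (- (b i - \<xi>)) - (if \<xi> < 0 then h_plus s else 0)\<bar> \<partial>lborel)
        \<le> ennreal (elevation_lipschitz_const s * L1_bound s (\<epsilon> i) (\<delta> i * s) T)" if "T \<ge> 0" for i T
      unfolding H_eq by (rule wave_profile.L1_shock_elevation[OF profile b[OF that]])
  qed (use assms(1) limC in auto)
  then have tH: "tends_L1_loc (\<lambda>i x t. wave s (H i) (x + - b i) t) (jump s (h_plus s) 0) F"
    by (simp add: wave_def algebra_simps)
  have "undular_bore s (H i) (U i)" if "(\<epsilon> i)\<^sup>2 < 4 * \<delta> i * s * alpha s" for i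
  proof -
    have "(\<epsilon> i)\<^sup>2 < 4 * (\<delta> i * s) * alpha s" using that by (simp add: mult.assoc)
    from wave_profile.oscillates[OF profile this]
    have osc: "\<exists>\<^sub>F x in at_bot. U i x > u_plus s" "\<exists>\<^sub>F x in at_bot. U i x < u_plus s"
      by (simp_all add: at_bot_mirror frequently_filtermap)
    have up: "u_plus s < s" by (rule u_plus_less)
    \<comment> \<open>Elevation is a strictly increasing function of velocity, so both oscillate
      about their rear states at the same points.\<close>
    have "(U i x > u_plus s) = (H i x > h_plus s)" "(U i x < u_plus s) = (H i x < h_plus s)" for x
      unfolding H_eq h_plus_def using U_less[of i x] up assms(1) by (simp_all add: elevation_less_iff)
    then show ?thesis using osc by (simp add: undular_bore_def oscillates_about_def)
  qed
  then show ?thesis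
    using u_plus_less entropic_shock[OF assms(1)] tU tH by (intro conjI exI[of _ "\<lambda>i. - b i"]) auto
qed

end
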